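(* Let $F:\mathbb{R}^n\times\mathbb{R}^q\to\mathbb{R}$ be of the form $F(x,z)=f(x)+z^\top(Ax-b)$, with $A\in\mathbb{R}^{q\times n}$ having full row rank, $b\in\mathbb{R}^q$, and $f:\mathbb{R}^n\to\mathbb{R}$ strongly convex, twice differentiable, and satisfying $mI\preceq\nabla^2f(x)\preceq MI$ for all $x\in\mathbb{R}^n$ and some constants $0<m\le M<\infty$. Let the map $x\mapsto\nabla^2f(x)$ be Lipschitz with some constant $L>0$. Then the set of saddle points $\mathrm{Saddle}(F)$ is a singleton. Let $\mathrm{Saddle}(F)=\{(x_*,z_* )\}$. Then, for any initial condition $(x(0),z(0))\in\mathbb{R}^n\times\mathbb{R}^q$, we have $$\lim_{k\to\infty}(x(t_k),z(t_k))=(x_*,z_* )$$ for the solution, starting at $(x(0),z(0))$, of the self-triggered saddle-point dynamics defined by $$\dot x(t)=-\nabla_xF(x(t_k),z(t_k)),\qquad\dot z(t)=\nabla_zF(x(t_k),z(t_k)),\qquad t\in[t_k,t_{k+1}),\ k\in\mathbb{Z}_{\ge0},$$ with $t_0=0$ and triggering times $$t_{k+1}=t_k+\frac{\tilde\lambda_m}{3(M^2+\|A\|^2)\,\xi(x(t_k),z(t_k))}.$$ Further, there exists $\mu_{(x(0),z(0))}>0$ such that the triggering times of this solution satisfy $$t_{k+1}-t_k\ge\mu_{(x(0),z(0))}\quad\text{for all }k\in\mathbb{N}.$$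
   Context: A point $(x_*,z_* )$ is a saddle point of $F$ if $F(x_*,z)\le F(x_*,z_* )\le F(x,z_* )$ for all $x\in\mathbb{R}^n$, $z\in\mathbb{R}^q$. Here $\nabla_xF(x,z)=\nabla f(x)+A^\top z$ and $\nabla_zF(x,z)=Ax-b$. $\|\cdot\|$ is the Euclidean norm on vectors and the induced norm on matrices. Solutions are understood in the Caratheodory sense (absolutely continuous, satisfying the equation almost everywhere); in discrete form, $(x(t_{k+1}),z(t_{k+1}))=(x(t_k),z(t_k))+(t_{k+1}-t_k)\,(-\nabla_xF(x(t_k),z(t_k)),\nabla_zF(x(t_k),z(t_k)))$. Fix $\beta_1>0$ and set: - $\beta_2=\dfrac{4\beta_1M^4}{m^2}$; - $\lambda_m=\min\{\tfrac12\beta_1m,\ \beta_1m^3\}$; - $\tilde\lambda_m=\lambda_m\min\{1,\lambda_{\mathrm{s}}(AA^\top)\}$, where $\lambda_{\mathrm{s}}(AA^\top)$ is the smallest nonzero eigenvalue of $AA^\top$; - $\xi_2=\max\{M,\|A\|\}$; - $\xi_1(x,z)=M\xi_2+L\|\nabla_xF(x,z)\|$; - $\xi(x,z)=\sqrt3\,\bigl(\beta_1^2(\xi_1(x,z)^2+\|A\|^4+\|A\|^2\xi_2^2)+\beta_2^2\bigr)^{1/2}$. *)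

theory Defs
  imports "HOL-Analysis.Analysis"
begin

section \<open>Gradients, Hessians, matrices\<close>

text \<open>The value is meaningful only where the function is differentiable; differentiability is
  always assumed separately.\<close>

definition gradient :: "('a::real_inner \<Rightarrow> real) \<Rightarrow> 'a \<Rightarrow> 'a" where
  "gradient f x = (THE g. GDERIV f x :> g)"

definition hessian :: "(real^'n \<Rightarrow> real) \<Rightarrow> real^'n \<Rightarrow> real^'n^'n" where
  "hessian f x = jacobian (gradient f) (at x)"

definition twice_differentiable :: "(real^'n \<Rightarrow> real) \<Rightarrow> bool" where
  "twice_differentiable f \<longleftrightarrow> f differentiable_on UNIV \<and> gradient f differentiable_on UNIV"

definition strongly_convex :: "('a::real_normed_vector \<Rightarrow> real) \<Rightarrow> bool" where
  "strongly_convex f \<longleftrightarrow> (\<exists>c>0. \<forall>x y. \<forall>\<theta>\<in>{0..1}.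
     f (\<theta> *\<^sub>R x + (1 - \<theta>) *\<^sub>R y)
       \<le> \<theta> * f x + (1 - \<theta>) * f y - c / 2 * \<theta> * (1 - \<theta>) * (norm (x - y))\<^sup>2)"

text \<open>The norm that the type \<^typ>\<open>real^'n^'m\<close> carries in the library is the Frobenius norm,
  so the norm induced by the Euclidean norms is written with \<^const>\<open>onorm\<close>.\<close>

definition matrix_norm :: "real^'n^'m \<Rightarrow> real" where
  "matrix_norm A = onorm (\<lambda>x. A *v x)"

text \<open>The Loewner order is the usual order on symmetric matrices; a Hessian of a twice
  (Frechet) differentiable function is symmetric.\<close>

definition pos_semidef :: "real^'n^'n \<Rightarrow> bool" where
  "pos_semidef P \<longleftrightarrow> transpose P = P \<and> (\<forall>v. 0 \<le> v \<bullet> (P *v v))"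

definition loewner_le :: "real^'n^'n \<Rightarrow> real^'n^'n \<Rightarrow> bool" (infix "\<preceq>" 50) where
  "P \<preceq> Q \<longleftrightarrow> pos_semidef (Q - P)"

definition eigenvalue :: "real^'n^'n \<Rightarrow> real \<Rightarrow> bool" where
  "eigenvalue P \<mu> \<longleftrightarrow> (\<exists>v. v \<noteq> 0 \<and> P *v v = \<mu> *\<^sub>R v)"

text \<open>Used for symmetric matrices only, all of whose eigenvalues are real.\<close>

definition smallest_nonzero_eigenvalue :: "real^'n^'n \<Rightarrow> real" where
  "smallest_nonzero_eigenvalue P = Min {\<mu>. \<mu> \<noteq> 0 \<and> eigenvalue P \<mu>}"


section \<open>Saddle points\<close>

definition Saddle :: "('a \<Rightarrow> 'b \<Rightarrow> real) \<Rightarrow> ('a \<times> 'b) set" where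
  "Saddle F = {(xs, zs). \<forall>x z. F xs z \<le> F xs zs \<and> F xs zs \<le> F x zs}"

definition grad_x :: "('a::real_inner \<Rightarrow> 'b \<Rightarrow> real) \<Rightarrow> 'a \<Rightarrow> 'b \<Rightarrow> 'a" where
  "grad_x F x z = gradient (\<lambda>y. F y z) x"

definition grad_z :: "('a \<Rightarrow> 'b::real_inner \<Rightarrow> real) \<Rightarrow> 'a \<Rightarrow> 'b \<Rightarrow> 'b" where
  "grad_z F x z = gradient (F x) z"

lemma gradient_eqI: "GDERIV f x :> g \<Longrightarrow> gradient f x = g"
  unfolding gradient_def
proof (rule the_equality)
  fix g' assume "GDERIV f x :> g" "GDERIV f x :> g'"
  then have "(\<lambda>h. h \<bullet> g) = (\<lambda>h. h \<bullet> g')"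
    unfolding gderiv_def by (rule has_derivative_unique)
  then have "h \<bullet> g' = h \<bullet> g" for h
    by (rule fun_cong[symmetric])
  then show "g' = g"
    using vector_eq_ldot by blast
qed

lemma gderiv_gradient:
  fixes f :: "real^'n \<Rightarrow> real"
  assumes "f differentiable (at x)"
  shows "GDERIV f x :> gradient f x"
proof -
  from assms obtain D where D: "(f has_derivative D) (at x)"
    unfolding differentiable_def by blast
  define g where "g = adjoint D 1"
  have "linear D" using D by (rule has_derivative_linear)
  then have "h \<bullet> g = D h" for h
    unfolding g_def by (simp only: adjoint_works inner_real_def mult_1_right)
  then have "D = (\<lambda>h. h \<bullet> g)" by (intro ext) (rule sym)
  with D have "GDERIV f x :> g" by (simp add: gderiv_def)
  then show ?thesis by (simp add: gradient_eqI)
qed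

lemma grad_x_lagrangian:
  fixes f :: "real^'n \<Rightarrow> real" and A :: "real^'n^'q"
  assumes "f differentiable (at x)"
  shows "grad_x (\<lambda>x z. f x + z \<bullet> (A *v x - b)) x z = gradient f x + transpose A *v z"
proof -
  have "((\<lambda>y. A *v y - b) has_derivative (\<lambda>h. A *v h)) (at x)"
    using has_derivative_diff[OF bounded_linear_imp_has_derivative has_derivative_const,
        OF matrix_vector_mul_bounded_linear[of A]]
    by simp
  then have "((\<lambda>y. z \<bullet> (A *v y - b)) has_derivative (\<lambda>h. z \<bullet> (A *v h))) (at x)"
    by (rule has_derivative_inner_right)
  with gderiv_gradient[OF assms]
  have "((\<lambda>y. f y + z \<bullet> (A *v y - b)) has_derivative
          (\<lambda>h. h \<bullet> gradient f x + z \<bullet> (A *v h))) (at x)"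
    unfolding gderiv_def by (rule has_derivative_add)
  also have "(\<lambda>h. h \<bullet> gradient f x + z \<bullet> (A *v h)) = (\<lambda>h. h \<bullet> (gradient f x + transpose A *v z))"
    by (simp only: inner_add_right transpose_matrix_vector flip: dot_lmul_matrix)
      (simp only: inner_commute[of "z v* A"])
  finally show ?thesis
    unfolding grad_x_def by (intro gradient_eqI) (simp add: gderiv_def)
qed

lemma grad_z_lagrangian:
  fixes A :: "real^'n^'q"
  shows "grad_z (\<lambda>x z. f x + z \<bullet> (A *v x - b)) x z = A *v x - b"
proof -
  have "((\<lambda>z. z \<bullet> (A *v x - b)) has_derivative (\<lambda>h. h \<bullet> (A *v x - b))) (at z)"
    by (rule has_derivative_inner_left) (rule has_derivative_ident)
  from has_derivative_add[OF has_derivative_const this, of "f x"]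
  show ?thesis
    unfolding grad_z_def by (intro gradient_eqI) (simp add: gderiv_def)
qed


section \<open>Constants of the triggering law\<close>

definition beta2 :: "real \<Rightarrow> real \<Rightarrow> real \<Rightarrow> real" where
  "beta2 \<beta>1 m M = 4 * \<beta>1 * M^4 / m\<^sup>2"

definition lambda_m :: "real \<Rightarrow> real \<Rightarrow> real" where
  "lambda_m \<beta>1 m = min (1/2 * \<beta>1 * m) (\<beta>1 * m^3)"

definition lambda_tilde :: "real \<Rightarrow> real \<Rightarrow> real^'n^'q \<Rightarrow> real" where
  "lambda_tilde \<beta>1 m A = lambda_m \<beta>1 m * min 1 (smallest_nonzero_eigenvalue (A ** transpose A))"

definition xi2 :: "real \<Rightarrow> real^'n^'q \<Rightarrow> real" where
  "xi2 M A = max M (matrix_norm A)"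

definition xi1 :: "(real^'n \<Rightarrow> real^'q \<Rightarrow> real) \<Rightarrow> real^'n^'q \<Rightarrow> real \<Rightarrow> real
    \<Rightarrow> real^'n \<Rightarrow> real^'q \<Rightarrow> real" where
  "xi1 F A M L x z = M * xi2 M A + L * norm (grad_x F x z)"

definition xi :: "(real^'n \<Rightarrow> real^'q \<Rightarrow> real) \<Rightarrow> real^'n^'q \<Rightarrow> real \<Rightarrow> real \<Rightarrow> real \<Rightarrow> real
    \<Rightarrow> real^'n \<Rightarrow> real^'q \<Rightarrow> real" where
  "xi F A \<beta>1 m M L x z = sqrt 3 *
     sqrt (\<beta>1\<^sup>2 * ((xi1 F A M L x z)\<^sup>2 + matrix_norm A ^ 4 + (matrix_norm A)\<^sup>2 * (xi2 M A)\<^sup>2)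
           + (beta2 \<beta>1 m M)\<^sup>2)"

definition trigger_step :: "(real^'n \<Rightarrow> real^'q \<Rightarrow> real) \<Rightarrow> real^'n^'q \<Rightarrow> real \<Rightarrow> real \<Rightarrow> real \<Rightarrow> real
    \<Rightarrow> real^'n \<Rightarrow> real^'q \<Rightarrow> real" where
  "trigger_step F A \<beta>1 m M L x z =
     lambda_tilde \<beta>1 m A / (3 * (M\<^sup>2 + (matrix_norm A)\<^sup>2) * xi F A \<beta>1 m M L x z)"


section \<open>Caratheodory solutions of the sampled dynamics\<close>

text \<open>Absolute continuity on an interval: small total length of finitely many non-overlapping
  closed subintervals forces small total variation over them.\<close>

definition absolutely_continuous_on :: "real set \<Rightarrow> (real \<Rightarrow> 'a::real_normed_vector) \<Rightarrow> bool" where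
  "absolutely_continuous_on S f \<longleftrightarrow>
     (\<forall>\<epsilon>>0. \<exists>\<delta>>0. \<forall>D T. D division_of T \<and> T \<subseteq> S \<and> (\<Sum>K\<in>D. Sup K - Inf K) < \<delta> \<longrightarrow>
        (\<Sum>K\<in>D. norm (f (Sup K) - f (Inf K))) < \<epsilon>)"

text \<open>\<open>t k\<close> is the \<open>k\<close>-th triggering time and \<open>\<tau>\<close> gives the waiting time as a function of the
  sampled state. Nothing is required beyond \<open>\<Union>k. {t k..<t (Suc k)}\<close>, so
  accumulation of triggering times is not excluded by the definition. Absolute continuity on each
  \<open>{t k..t (Suc k)}\<close> amounts to absolute continuity on every compact interval contained in that
  union, and ties the pieces together continuously.\<close>

definition self_triggered_solution ::
  "('a::euclidean_space \<Rightarrow> 'b::euclidean_space \<Rightarrow> real) \<Rightarrow> ('a \<Rightarrow> 'b \<Rightarrow> real)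
     \<Rightarrow> (nat \<Rightarrow> real) \<Rightarrow> (real \<Rightarrow> 'a) \<Rightarrow> (real \<Rightarrow> 'b) \<Rightarrow> bool" where
  "self_triggered_solution F \<tau> t x z \<longleftrightarrow>
     t 0 = 0 \<and>
     (\<forall>k. t (Suc k) = t k + \<tau> (x (t k)) (z (t k))) \<and>
     (\<forall>k. absolutely_continuous_on {t k..t (Suc k)} x \<and>
          absolutely_continuous_on {t k..t (Suc k)} z) \<and>
     (\<forall>k. AE s in lebesgue. s \<in> {t k..<t (Suc k)} \<longrightarrow>
          (x has_vector_derivative - grad_x F (x (t k)) (z (t k))) (at s) \<and>
          (z has_vector_derivative grad_z F (x (t k)) (z (t k))) (at s))"

end

theory Submission
  imports Defs
begin

text \<open>
  Write \<open>g = \<nabla>f(x) + A\<^sup>T z\<close> and \<open>w = A x - b\<close> for the two partial gradients, so that the sampled dynamics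
  is the explicit Euler scheme \<open>(x, z) \<mapsto> (x - \<tau> g, z + \<tau> w)\<close> with a step \<open>\<tau>\<close> that depends on the state.
  The saddle points are the common zeros of \<open>g\<close> and \<open>w\<close>. One exists because \<open>f\<close> attains its minimum on
  the affine space \<open>A x = b\<close> and the surjectivity of \<open>A\<close> supplies a multiplier; it is unique because the
  gradient of \<open>f\<close> is strongly monotone and \<open>A\<^sup>T\<close> is injective.

  Convergence rests on the Lyapunov function
  \<open>V = (\<beta>1 / 2) (|g|\<^sup>2 + |w|\<^sup>2) + (\<beta>2 / 2) |(x, z) - (xs, zs)|\<^sup>2\<close>.
  In its derivative along the flow the terms that couple \<open>x\<close> and \<open>z\<close> through \<open>A\<close> cancel. The distance term
  then contributes dissipation in \<open>x\<close> alone, while the gradient term contributes dissipation in \<open>A\<^sup>T (z - zs)\<close>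
  at the price of a term in \<open>x - xs\<close>; the constant \<open>\<beta>2\<close> is large enough to absorb that price. Hence the
  derivative is at most \<open>- \<rho> |(x, z) - (xs, zs)|\<^sup>2\<close> with \<open>\<rho> = lambda_tilde\<close> (\<open>lyap_rate_le\<close>).

  Over one step the field is frozen at the sample. Since the Hessian of \<open>f\<close> is Lipschitz, the derivative of \<open>V\<close>
  drifts at most linearly away from its value at the sample, with a slope bounded by \<open>curvature\<close> times the
  squared speed, so \<open>V\<close> changes by at most a quadratic in the step length (\<open>lyap_along_step\<close>). The
  quantity \<open>xi\<close> dominates \<open>curvature\<close> up to the factor \<open>3/2\<close> (\<open>curvature_le_xi\<close>). At the triggering
  time the quadratic term therefore uses up at most three quarters of the guaranteed decrease, and each step lowers
  \<open>V\<close> by at least \<open>\<rho> \<tau> |(x, z) - (xs, zs)|\<^sup>2 / 4\<close> (\<open>lyap_decrease\<close>).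

  As \<open>V\<close> never increases, \<open>|g|\<close> stays below a bound fixed by the initial value of \<open>V\<close>. This bounds \<open>xi\<close>
  from above, hence the waiting times from below (\<open>dwell_le_\<tau>\<close>). The successive decrements of \<open>V\<close> tend to
  zero, so the distance to the saddle point does as well.

  A Caratheodory solution is only known to be absolutely continuous with the prescribed derivative almost everywhere.
  That its samples are exactly the Euler iterates is the fundamental theorem of calculus for absolutely continuous
  functions, in the case of a constant derivative (\<open>absolutely_continuous_affine_increment\<close>).
\<close>

section \<open>Absolutely continuous functions with constant derivative\<close>

text \<open>Away from a null set \<open>N\<close> the function follows its tangent, and absolute continuity controls it on short
  collections of intervals. So cover \<open>N\<close> by an open set \<open>G\<close> of small measure and take a tagged division of
  \<open>{a..b}\<close> whose intervals either follow the tangent at a tag outside \<open>N\<close> or, if their tag is in \<open>N\<close>, lie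
  inside \<open>G\<close>. The first kind contributes an error proportional to \<open>b - a\<close>, the second kind is short in total.\<close>

lemma absolutely_continuous_affine_increment:
  fixes f :: "real \<Rightarrow> 'a::real_normed_vector"
  assumes ab: "a \<le> b" and ac: "absolutely_continuous_on {a..b} f"
    and deriv: "AE s in lebesgue. s \<in> {a..<b} \<longrightarrow> (f has_vector_derivative v) (at s)"
  shows "f b - f a = (b - a) *\<^sub>R v"
proof -
  obtain N where N: "N \<in> null_sets lebesgue"
      "\<And>s. s \<in> {a..b} \<Longrightarrow> s \<notin> N \<Longrightarrow> (f has_vector_derivative v) (at s)"
  proof -
    obtain N0 where N0: "{s \<in> space lebesgue. \<not> (s \<in> {a..<b} \<longrightarrow> (f has_vector_derivative v) (at s))} \<subseteq> N0"
        "emeasure lebesgue N0 = 0" "N0 \<in> sets lebesgue"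
      using deriv by (rule AE_E)
    have "insert b N0 \<in> null_sets lebesgue"
    proof -
      have "{b} \<in> null_sets lebesgue" by (metis negligible_iff_null_sets negligible_sing)
      moreover have "N0 \<in> null_sets lebesgue" using N0(2,3) by blast
      ultimately show ?thesis using null_sets.Un by fastforce
    qed
    moreover have "(f has_vector_derivative v) (at s)" if "s \<in> {a..b}" "s \<notin> insert b N0" for s
      using that N0(1) by fastforce
    ultimately show thesis by (rule that)
  qed
  define h where "h s = f s - s *\<^sub>R v" for s
  have "norm (h b - h a) \<le> e" if "e > 0" for e :: real
  proof -
    (* The error budget: \<epsilon> (b - a) from tags outside N, \<epsilon> from the variation of f over the intervals
       inside G, and \<epsilon> from the variation of s *\<^sub>R v over them. *)
    define \<epsilon> where "\<epsilon> = e / (b - a + 2)"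
    have "\<epsilon> * (b - a + 2) = e" using ab by (simp add: \<epsilon>_def)
    then have \<epsilon>_sum: "\<epsilon> * (b - a) + \<epsilon> + \<epsilon> = e" by (simp add: algebra_simps)
    have \<epsilon>: "\<epsilon> > 0" using that ab by (simp add: \<epsilon>_def)
    obtain \<delta> where \<delta>: "\<delta> > 0" "\<And>D T. D division_of T \<Longrightarrow> T \<subseteq> {a..b} \<Longrightarrow> (\<Sum>K\<in>D. Sup K - Inf K) < \<delta> \<Longrightarrow>
        (\<Sum>K\<in>D. norm (f (Sup K) - f (Inf K))) < \<epsilon>"
      using ac \<epsilon> unfolding absolutely_continuous_on_def by meson
    define \<delta>' where "\<delta>' = min \<delta> (\<epsilon> / (norm v + 1))"
    have \<delta>': "\<delta>' > 0" "\<delta>' \<le> \<delta>" "\<delta>' * norm v \<le> \<epsilon>"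
    proof -
      show "\<delta>' > 0" "\<delta>' \<le> \<delta>" using \<delta>(1) \<epsilon> unfolding \<delta>'_def
        by (auto simp: add_nonneg_pos)
      have "\<delta>' * norm v \<le> \<epsilon> / (norm v + 1) * (norm v + 1)"
        unfolding \<delta>'_def using \<epsilon> \<delta>(1) by (intro mult_mono) auto
      also have "\<dots> = \<epsilon>" using norm_ge_zero[of v] by (simp del: norm_ge_zero)
      finally show "\<delta>' * norm v \<le> \<epsilon>" .
    qed
    obtain G where G: "open G" "N \<subseteq> G" "(G - N) \<in> lmeasurable" "emeasure lebesgue (G - N) < ennreal \<delta>'"
      using sets_lebesgue_outer_open[of N \<delta>'] N(1) \<delta>'(1) by auto
    have Gm: "G \<in> lmeasurable" "measure lebesgue G < \<delta>'"
    proof -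
      have "emeasure lebesgue G = emeasure lebesgue (G - N)"
        using emeasure_Diff_null_set[OF N(1), of G] G(1) by (simp add: borel_open sets_completionI_sets)
      then have e: "emeasure lebesgue G < ennreal \<delta>'" using G(4) by simp
      then show "G \<in> lmeasurable"
        using G(1) by (intro fmeasurableI) (auto simp: less_top[symmetric] borel_open sets_completionI_sets intro: less_trans)
      then show "measure lebesgue G < \<delta>'"
        using e \<delta>'(1) by (simp add: emeasure_eq_measure2 ennreal_less_iff)
    qed
    (* Q s r: the radius r is admissible for a division interval with tag s. *)
    define Q where "Q s r \<longleftrightarrow> r > 0 \<and> (if s \<in> N then ball s r \<subseteq> G else s \<in> {a..b} \<longrightarrow>
        (\<forall>y. norm (y - s) < r \<longrightarrow> norm (f y - f s - (y - s) *\<^sub>R v) \<le> \<epsilon> * norm (y - s)))" for s r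
    have "\<exists>r. Q s r" for s
    proof (cases "s \<in> N")
      case True
      then have "s \<in> G" using G(2) by blast
      then show ?thesis using True G(1) unfolding Q_def open_contains_ball by simp
    next
      case False
      show ?thesis
      proof (cases "s \<in> {a..b}")
        case True
        then obtain r where "r > 0" "\<forall>y. norm (y - s) < r \<longrightarrow> norm (f y - f s - (y - s) *\<^sub>R v) \<le> \<epsilon> * norm (y - s)"
          using N(2)[OF True False] \<epsilon> unfolding has_vector_derivative_def has_derivative_within_alt
          by (metis UNIV_I)
        then have "Q s r" using False unfolding Q_def by simp
        then show ?thesis ..
      next
        case outside: False
        then show ?thesis using False unfolding Q_def by (auto intro: exI[of _ 1])
      qed
    qed
    then obtain d where Q: "\<And>s. Q s (d s)" by metis
    have d: "d s > 0" "s \<in> N \<Longrightarrow> ball s (d s) \<subseteq> G"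
      "s \<notin> N \<Longrightarrow> s \<in> {a..b} \<Longrightarrow> norm (y - s) < d s \<Longrightarrow> norm (f y - f s - (y - s) *\<^sub>R v) \<le> \<epsilon> * norm (y - s)"
      for s y
      using Q[of s] by (auto simp: Q_def)
    have gauge: "gauge (\<lambda>x. ball x (d x))" using d(1) by (simp add: gauge_def)
    obtain p where p: "p tagged_division_of (cbox a b)" "(\<lambda>x. ball x (d x)) fine p"
      by (rule fine_division_exists[OF gauge])
    note pD = tagged_division_ofD[OF p(1)]
    define P where "P = {xK \<in> p. fst xK \<in> N}"
    have Pp: "P \<subseteq> p" "finite p" using pD(1) by (auto simp: P_def)
    have P: "P tagged_division_of \<Union>(snd ` P)"
      using tagged_partial_division_of_Union_self[OF tagged_partial_division_subset[OF _ Pp(1)]] p(1)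
      unfolding tagged_division_of_def by blast
    have Kform: "\<exists>u w. K = {u..w} \<and> u \<le> x \<and> x \<le> w \<and> K \<subseteq> {a..b} \<and> K \<subseteq> ball x (d x)" if xK: "(x, K) \<in> p" for x K
    proof -
      obtain u w where "K = cbox u w" using pD(4)[OF xK] by blast
      moreover have "x \<in> K" "K \<subseteq> cbox a b" using pD(2,3)[OF xK] by auto
      moreover have "K \<subseteq> ball x (d x)" using p(2) xK by (auto simp: fine_def)
      ultimately show ?thesis by auto
    qed
    let ?D = "snd ` P"
    have KD: "(\<exists>u w. K = {u..w} \<and> u \<le> w) \<and> K \<subseteq> G \<and> K \<subseteq> {a..b}" if "K \<in> ?D" for K
    proof -
      obtain x where x: "(x, K) \<in> p" "x \<in> N" using \<open>K \<in> ?D\<close> by (auto simp: P_def)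
      obtain u w where "K = {u..w}" "u \<le> x" "x \<le> w" "K \<subseteq> {a..b}" "K \<subseteq> ball x (d x)"
        using Kform[OF x(1)] by (elim exE conjE)
      moreover from this have "u \<le> w" by linarith
      moreover have "ball x (d x) \<subseteq> G" by (rule d(2)[OF x(2)])
      ultimately show ?thesis by blast
    qed
    have D: "?D division_of \<Union>?D" using division_of_tagged_division[OF P] .
    (* The same interval may carry two tags, but then it is degenerate and contributes nothing; so sums over
       the tagged intervals are sums over the intervals. *)
    have swap: "(\<Sum>(x, K)\<in>P. \<phi> (Sup K) (Inf K)) = (\<Sum>K\<in>?D. \<phi> (Sup K) (Inf K))"
      if \<phi>: "\<And>u. \<phi> u u = 0" for \<phi> :: "real \<Rightarrow> real \<Rightarrow> real"
    proof -
      have eq: "(\<Sum>(x, K)\<in>P. if interior K = {} then 0 else \<phi> (Sup K) (Inf K))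
          = (\<Sum>K\<in>?D. if interior K = {} then 0 else \<phi> (Sup K) (Inf K))"
        by (rule sum.over_tagged_division_lemma[OF P]) auto
      have *: "\<phi> (Sup K) (Inf K) = (if interior K = {} then 0 else \<phi> (Sup K) (Inf K))" if K: "K \<in> ?D" for K
      proof -
        obtain u w where "K = {u..w}" "u \<le> w" using KD[OF K] by (elim exE conjE)
        then show ?thesis using \<phi> by (cases "u = w") auto
      qed
      have "(\<Sum>(x, K)\<in>P. \<phi> (Sup K) (Inf K)) = (\<Sum>(x, K)\<in>P. if interior K = {} then 0 else \<phi> (Sup K) (Inf K))"
        using * by (intro sum.cong) force+
      with eq show ?thesis using * by (simp cong: sum.cong)
    qed
    have lenD: "(\<Sum>K\<in>?D. Sup K - Inf K) < \<delta>'"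
    proof -
      have "(\<Sum>K\<in>?D. Sup K - Inf K) = (\<Sum>K\<in>?D. measure lebesgue K)"
      proof (rule sum.cong)
        fix K assume "K \<in> ?D"
        then obtain u w where "K = {u..w}" "u \<le> w" using KD by meson
        then show "Sup K - Inf K = measure lebesgue K" by simp
      qed simp
      also have "\<dots> = measure lebesgue (\<Union>?D)" by (rule content_division[OF D])
      also have "\<dots> \<le> measure lebesgue G"
      proof (rule measure_mono_fmeasurable)
        show "\<Union>?D \<subseteq> G" using KD by (intro Union_least) blast
        show "\<Union>?D \<in> sets lebesgue" using lmeasurable_division[OF D] by auto
      qed (rule Gm)
      finally show ?thesis using Gm(2) by simp
    qed
    have fD: "(\<Sum>K\<in>?D. norm (f (Sup K) - f (Inf K))) < \<epsilon>"
    proof (rule \<delta>(2)[OF D])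
      show "\<Union>?D \<subseteq> {a..b}" using KD by (intro Union_least) blast
    qed (use lenD \<delta>'(2) in simp)
    have hP: "norm (\<Sum>(x,K)\<in>P. h (Sup K) - h (Inf K)) \<le> \<epsilon> + \<epsilon>"
    proof -
      have "norm (\<Sum>(x,K)\<in>P. h (Sup K) - h (Inf K)) \<le>
          (\<Sum>(x,K)\<in>P. norm (f (Sup K) - f (Inf K)) + \<bar>Sup K - Inf K\<bar> * norm v)"
      proof (rule sum_norm_le, clarify)
        fix x K
        have "h (Sup K) - h (Inf K) = (f (Sup K) - f (Inf K)) - (Sup K - Inf K) *\<^sub>R v"
          by (simp add: h_def algebra_simps)
        then show "norm (h (Sup K) - h (Inf K)) \<le> norm (f (Sup K) - f (Inf K)) + \<bar>Sup K - Inf K\<bar> * norm v"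
          by (metis norm_scaleR norm_triangle_ineq4)
      qed
      also have "\<dots> = (\<Sum>K\<in>?D. norm (f (Sup K) - f (Inf K)) + \<bar>Sup K - Inf K\<bar> * norm v)"
        by (rule swap) simp
      also have "\<dots> = (\<Sum>K\<in>?D. norm (f (Sup K) - f (Inf K))) + (\<Sum>K\<in>?D. \<bar>Sup K - Inf K\<bar>) * norm v"
        by (simp add: sum.distrib sum_distrib_right)
      also have "(\<Sum>K\<in>?D. \<bar>Sup K - Inf K\<bar>) = (\<Sum>K\<in>?D. Sup K - Inf K)"
      proof (rule sum.cong)
        fix K assume "K \<in> ?D"
        then obtain u w where "K = {u..w}" "u \<le> w" using KD by meson
        then show "\<bar>Sup K - Inf K\<bar> = Sup K - Inf K" by simp
      qed simp
      also have "(\<Sum>K\<in>?D. norm (f (Sup K) - f (Inf K))) + (\<Sum>K\<in>?D. Sup K - Inf K) * norm v \<le> \<epsilon> + \<delta>' * norm v"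
        using fD lenD by (intro add_mono mult_right_mono) auto
      also have "\<dots> \<le> \<epsilon> + \<epsilon>" using \<delta>'(3) by simp
      finally show ?thesis .
    qed
    have hQ: "norm (\<Sum>(x,K)\<in>p - P. h (Sup K) - h (Inf K)) \<le> \<epsilon> * (b - a)"
    proof -
      have "norm (\<Sum>(x,K)\<in>p - P. h (Sup K) - h (Inf K)) \<le> (\<Sum>(x,K)\<in>p - P. \<epsilon> * (Sup K - Inf K))"
      proof (rule sum_norm_le, clarify)
        fix x K assume xK: "(x, K) \<in> p" "(x, K) \<notin> P"
        then obtain u w where K: "K = {u..w}" "u \<le> x" "x \<le> w" "K \<subseteq> {a..b}" "K \<subseteq> ball x (d x)"
          using Kform[OF xK(1)] by (elim exE conjE)
        have x: "x \<notin> N" "x \<in> {a..b}" using xK K by (auto simp: P_def)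
        have "u \<in> K" "w \<in> K" using K(1-3) by auto
        then have "u \<in> ball x (d x)" "w \<in> ball x (d x)" using K(5) by blast+
        then have "norm (f u - f x - (u - x) *\<^sub>R v) \<le> \<epsilon> * (x - u)" "norm (f w - f x - (w - x) *\<^sub>R v) \<le> \<epsilon> * (w - x)"
          using d(3)[OF x, of u] d(3)[OF x, of w] K(2,3) by (auto simp: dist_real_def)
        moreover have "h w - h u = (f w - f x - (w - x) *\<^sub>R v) - (f u - f x - (u - x) *\<^sub>R v)"
          by (simp add: h_def algebra_simps)
        ultimately have "norm (h w - h u) \<le> \<epsilon> * (w - x) + \<epsilon> * (x - u)"
          by (metis add_mono norm_triangle_ineq4 order_trans)
        also have "\<dots> = \<epsilon> * (w - u)" by (simp add: algebra_simps)
        finally show "norm (h (Sup K) - h (Inf K)) \<le> \<epsilon> * (Sup K - Inf K)" using K by simp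
      qed
      also have "\<dots> \<le> (\<Sum>(x,K)\<in>p. \<epsilon> * (Sup K - Inf K))"
      proof (rule sum_mono2[OF Pp(2)])
        fix xK assume "xK \<in> p - (p - P)"
        then obtain x K where xK: "xK = (x, K)" "(x, K) \<in> p" by (cases xK) auto
        obtain u w where "K = {u..w}" "u \<le> x" "x \<le> w" using Kform[OF xK(2)] by (elim exE conjE)
        then show "0 \<le> (case xK of (x, K) \<Rightarrow> \<epsilon> * (Sup K - Inf K))" using xK(1) \<epsilon> by simp
      qed auto
      also have "\<dots> = \<epsilon> * (\<Sum>(x,K)\<in>p. Sup K - Inf K)" by (simp add: sum_distrib_left case_prod_unfold)
      also have "(\<Sum>(x,K)\<in>p. Sup K - Inf K) = b - a"
        using additive_tagged_division_1[OF ab, of p "\<lambda>x. x"] p(1) by simp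
      finally show ?thesis .
    qed
    have "h b - h a = (\<Sum>(x,K)\<in>p. h (Sup K) - h (Inf K))"
      using additive_tagged_division_1[OF ab, of p h] p(1) by simp
    also have "\<dots> = (\<Sum>(x,K)\<in>p - P. h (Sup K) - h (Inf K)) + (\<Sum>(x,K)\<in>P. h (Sup K) - h (Inf K))"
      by (rule sum.subset_diff[OF Pp])
    finally have "norm (h b - h a) \<le> \<epsilon> * (b - a) + (\<epsilon> + \<epsilon>)"
      using norm_triangle_le[OF add_mono[OF hQ hP]] by simp
    then show ?thesis using \<epsilon>_sum by simp
  qed
  then have "norm (h b - h a) \<le> 0" by (rule field_le_epsilon[of _ 0, simplified])
  then show ?thesis by (simp add: h_def algebra_simps)
qed

lemma affine_absolutely_continuous:
  fixes f :: "real \<Rightarrow> 'a::real_normed_vector"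
  assumes f: "\<And>s. s \<in> {a..b} \<Longrightarrow> f s = c + (s - a) *\<^sub>R v"
  shows "absolutely_continuous_on {a..b} f"
  unfolding absolutely_continuous_on_def
proof (intro allI impI)
  fix \<epsilon> :: real assume \<epsilon>: "\<epsilon> > 0"
  have "(\<Sum>K\<in>D. norm (f (Sup K) - f (Inf K))) < \<epsilon>"
    if D: "D division_of T" "T \<subseteq> {a..b}" "(\<Sum>K\<in>D. Sup K - Inf K) < \<epsilon> / (norm v + 1)" for D T
  proof -
    have "(\<Sum>K\<in>D. norm (f (Sup K) - f (Inf K))) = (\<Sum>K\<in>D. (Sup K - Inf K) * norm v)"
    proof (rule sum.cong)
      fix K assume K: "K \<in> D"
      obtain u w where uw: "K = cbox u w" "K \<noteq> {}" "K \<subseteq> T" using division_ofD(2-4)[OF D(1) K] by blast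
      then have "u \<le> w" by auto
      then have "u \<in> K" "w \<in> K" using uw(1) by auto
      then have "u \<in> {a..b}" "w \<in> {a..b}" using uw(3) D(2) by blast+
      then have "f w - f u = (w - u) *\<^sub>R v" using f[of u] f[of w] by (simp add: scaleR_diff_left)
      then show "norm (f (Sup K) - f (Inf K)) = (Sup K - Inf K) * norm v"
        using \<open>u \<le> w\<close> uw(1) by simp
    qed simp
    also have "\<dots> = (\<Sum>K\<in>D. Sup K - Inf K) * norm v" by (simp add: sum_distrib_right)
    also have "\<dots> \<le> \<epsilon> / (norm v + 1) * norm v" using D(3) by (intro mult_right_mono) auto
    also have "\<dots> < \<epsilon>" using \<epsilon> by (simp add: field_simps add_pos_nonneg)
    finally show ?thesis .
  qed
  moreover have "\<epsilon> / (norm v + 1) > 0" using \<epsilon> by (simp add: add_nonneg_pos)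
  ultimately show "\<exists>\<delta>>0. \<forall>D T. D division_of T \<and> T \<subseteq> {a..b} \<and> (\<Sum>K\<in>D. Sup K - Inf K) < \<delta> \<longrightarrow>
        (\<Sum>K\<in>D. norm (f (Sup K) - f (Inf K))) < \<epsilon>" by blast
qed


section \<open>Symmetric matrices and matrix norms\<close>

lemma inner_matrix_vector_mult:
  fixes A :: "real^'n^'m"
  shows "w \<bullet> (A *v x) = (transpose A *v w) \<bullet> x"
  by (metis dot_lmul_matrix transpose_matrix_vector)

lemma matrix_vector_mult_uminus: "B *v (- u) = - (B *v (u :: real^'n))"
  by (rule linear_neg[OF matrix_vector_mul_linear])

lemma norm_matrix_vector_mult_le: "norm (A *v x) \<le> matrix_norm A * norm x"
  unfolding matrix_norm_def by (rule onorm[OF matrix_vector_mul_bounded_linear])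

lemma matrix_norm_nonneg: "0 \<le> matrix_norm A"
  unfolding matrix_norm_def by (rule onorm_pos_le[OF matrix_vector_mul_bounded_linear])

lemma norm_transpose_mult_le: "norm (transpose A *v w) \<le> matrix_norm A * norm w"
proof (cases "transpose A *v w = 0")
  case True then show ?thesis by (simp add: matrix_norm_nonneg)
next
  case False
  let ?y = "transpose A *v w"
  have "norm ?y * norm ?y = w \<bullet> (A *v ?y)"
    by (simp add: inner_matrix_vector_mult power2_norm_eq_inner flip: power2_eq_square)
  also have "\<dots> \<le> norm w * norm (A *v ?y)" by (rule norm_cauchy_schwarz)
  also have "\<dots> \<le> norm w * (matrix_norm A * norm ?y)"
    by (intro mult_left_mono norm_matrix_vector_mult_le) simp
  finally have "norm ?y * norm ?y \<le> (matrix_norm A * norm w) * norm ?y" by (simp add: mult_ac)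
  then show ?thesis using False by simp
qed

text \<open>The form is minimal at \<open>v\<close>, so it cannot decrease in the direction of \<open>- Q v\<close>, which it would to first
  order unless \<open>Q v = 0\<close>.\<close>

lemma pos_semidef_form_zero:
  assumes Q: "pos_semidef Q" and v: "v \<bullet> (Q *v v) = 0"
  shows "Q *v v = 0"
proof (rule ccontr)
  assume nz: "Q *v v \<noteq> 0"
  define w where "w = Q *v v"
  define W c where "W = w \<bullet> w" and "c = w \<bullet> (Q *v w)"
  have sym: "transpose Q = Q" and nn: "\<And>u. 0 \<le> u \<bullet> (Q *v u)" using Q by (auto simp: pos_semidef_def)
  have W: "W > 0" using nz by (simp add: W_def w_def)
  have c: "c \<ge> 0" using nn by (simp add: c_def)
  have vw: "v \<bullet> (Q *v w) = W"
    unfolding inner_matrix_vector_mult sym by (simp add: W_def w_def)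
  (* Moving v by - r w changes the form by r^2 c - 2 r W, which this r makes negative. *)
  define r where "r = W / (c + 1)"
  have r: "r > 0" "W = r * (c + 1)" using W c by (auto simp: r_def)
  have "0 \<le> (v - r *\<^sub>R w) \<bullet> (Q *v (v - r *\<^sub>R w))" by (rule nn)
  also have "\<dots> = r\<^sup>2 * c - 2 * r * W"
    using v vw by (simp add: matrix_vector_mult_diff_distrib matrix_vector_mult_scaleR inner_diff_left
        inner_diff_right power2_eq_square flip: c_def w_def) (simp add: W_def algebra_simps)
  also have "\<dots> = - (r\<^sup>2 * (c + 2))" using r(2) by (simp add: algebra_simps power2_eq_square)
  also have "\<dots> < 0" using r(1) c by simp
  finally show False by simp
qed

text \<open>The Rayleigh quotient attains its minimum \<open>\<mu>\<close> on the unit sphere. There the positive semidefinite form of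
  \<open>P - \<mu> I\<close> vanishes, so the minimizer is an eigenvector.\<close>

lemma symmetric_min_rayleigh_eigenvector:
  fixes P :: "real^'n^'n"
  assumes sym: "transpose P = P"
  obtains \<mu> v where "v \<noteq> 0" "P *v v = \<mu> *\<^sub>R v" "\<And>w. \<mu> * (w \<bullet> w) \<le> w \<bullet> (P *v w)"
proof -
  have "\<exists>v\<in>sphere 0 1. \<forall>w\<in>sphere (0::real^'n) 1. v \<bullet> (P *v v) \<le> w \<bullet> (P *v w)"
  proof (rule continuous_attains_inf)
    show "sphere (0::real^'n) 1 \<noteq> {}" by simp
    show "continuous_on (sphere 0 1) (\<lambda>v. v \<bullet> (P *v v))"
      by (intro continuous_intros linear_continuous_on matrix_vector_mul_bounded_linear)
  qed simp
  then obtain v where v: "norm v = 1" "\<And>w. norm w = 1 \<Longrightarrow> v \<bullet> (P *v v) \<le> w \<bullet> (P *v w)"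
    by (auto simp: dist_norm)
  define \<mu> where "\<mu> = v \<bullet> (P *v v)"
  have min: "\<mu> * (w \<bullet> w) \<le> w \<bullet> (P *v w)" for w
  proof (cases "w = 0")
    case False
    define u where "u = w /\<^sub>R norm w"
    have w: "w = norm w *\<^sub>R u" using False by (simp add: u_def)
    have "\<mu> \<le> u \<bullet> (P *v u)" unfolding \<mu>_def using False by (intro v(2)) (simp add: u_def)
    then have "\<mu> * (norm w)\<^sup>2 \<le> (u \<bullet> (P *v u)) * (norm w)\<^sup>2" by (intro mult_right_mono) auto
    also have "\<dots> = w \<bullet> (P *v w)"
    proof -
      have "w \<bullet> (P *v w) = (norm w *\<^sub>R u) \<bullet> (P *v (norm w *\<^sub>R u))" using w by simp
      then show ?thesis by (simp add: matrix_vector_mult_scaleR power2_eq_square)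
    qed
    finally show ?thesis by (simp add: power2_norm_eq_inner)
  qed simp
  have form: "u \<bullet> ((P - \<mu> *\<^sub>R mat 1) *v u) = u \<bullet> (P *v u) - \<mu> * (u \<bullet> u)" for u
    by (simp add: matrix_vector_mult_diff_rdistrib inner_diff_right flip: scaleR_matrix_vector_assoc)
  have "pos_semidef (P - \<mu> *\<^sub>R mat 1)"
    unfolding pos_semidef_def form using min sym by (simp add: transpose_def vec_eq_iff mat_def)
  moreover have "v \<bullet> ((P - \<mu> *\<^sub>R mat 1) *v v) = 0"
    unfolding form using v(1) by (simp add: \<mu>_def norm_eq_1)
  ultimately have "(P - \<mu> *\<^sub>R mat 1) *v v = 0" by (rule pos_semidef_form_zero)
  then have "P *v v = \<mu> *\<^sub>R v"
    by (simp add: matrix_vector_mult_diff_rdistrib flip: scaleR_matrix_vector_assoc)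
  then show thesis using that[of v \<mu>] v(1) min by force
qed

text \<open>Eigenvectors of distinct eigenvalues are orthogonal, hence linearly independent. Finiteness is what gives
  the minimum in \<^const>\<open>smallest_nonzero_eigenvalue\<close> its meaning.\<close>

lemma finite_eigenvalues_symmetric:
  fixes P :: "real^'n^'n"
  assumes sym: "transpose P = P"
  shows "finite {\<mu>. eigenvalue P \<mu>}"
proof -
  have "\<forall>\<mu>. \<exists>v. eigenvalue P \<mu> \<longrightarrow> v \<noteq> 0 \<and> P *v v = \<mu> *\<^sub>R v"
    unfolding eigenvalue_def by blast
  then obtain e where e: "\<And>\<mu>. eigenvalue P \<mu> \<Longrightarrow> e \<mu> \<noteq> 0 \<and> P *v e \<mu> = \<mu> *\<^sub>R e \<mu>"
    by metis
  have orth: "e \<mu> \<bullet> e \<nu> = 0" if "eigenvalue P \<mu>" "eigenvalue P \<nu>" "\<mu> \<noteq> \<nu>" for \<mu> \<nu>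
  proof -
    have "e \<mu> \<bullet> (P *v e \<nu>) = (P *v e \<mu>) \<bullet> e \<nu>" by (simp add: inner_matrix_vector_mult sym)
    then have "(\<nu> - \<mu>) * (e \<mu> \<bullet> e \<nu>) = 0" using e that by (simp add: algebra_simps)
    then show ?thesis using that by simp
  qed
  let ?E = "{\<mu>. eigenvalue P \<mu>}"
  have inj: "inj_on e ?E"
    using orth e by (intro inj_onI) (metis inner_eq_zero_iff mem_Collect_eq)
  have "independent (e ` ?E)"
    by (rule pairwise_orthogonal_independent) (use orth e in \<open>auto simp: pairwise_def orthogonal_def\<close>)
  then have "finite (e ` ?E)" by (rule finiteI_independent)
  then show ?thesis using inj by (rule finite_imageD)
qed

lemma smallest_nonzero_eigenvalue_pos_def:
  fixes P :: "real^'n^'n"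
  assumes sym: "transpose P = P" and pd: "\<And>v. v \<noteq> 0 \<Longrightarrow> 0 < v \<bullet> (P *v v)"
  shows "0 < smallest_nonzero_eigenvalue P"
    and "smallest_nonzero_eigenvalue P * (w \<bullet> w) \<le> w \<bullet> (P *v w)"
proof -
  let ?S = "{\<mu>. \<mu> \<noteq> 0 \<and> eigenvalue P \<mu>}"
  have pos: "0 < \<mu>" if S: "\<mu> \<in> ?S" for \<mu>
  proof -
    obtain v where "v \<noteq> 0" "P *v v = \<mu> *\<^sub>R v" using S unfolding eigenvalue_def by blast
    then show ?thesis using pd[of v] inner_ge_zero[of v] by (auto simp: zero_less_mult_iff)
  qed
  obtain \<mu> v where v: "v \<noteq> 0" "P *v v = \<mu> *\<^sub>R v" and min: "\<And>w. \<mu> * (w \<bullet> w) \<le> w \<bullet> (P *v w)"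
    by (rule symmetric_min_rayleigh_eigenvector[OF sym]) (rule that; assumption)
  have "0 < \<mu> * (v \<bullet> v)" using pd[OF v(1)] v(2) by simp
  then have \<mu>: "\<mu> \<in> ?S" using v by (auto simp: eigenvalue_def)
  have fin: "finite ?S" using finite_eigenvalues_symmetric[OF sym] by (rule rev_finite_subset) auto
  then have "Min ?S \<in> ?S" using \<mu> by (intro Min_in) auto
  then show "0 < smallest_nonzero_eigenvalue P" unfolding smallest_nonzero_eigenvalue_def by (rule pos)
  have "Min ?S \<le> \<mu>" using fin \<mu> by (rule Min_le)
  then have "Min ?S * (w \<bullet> w) \<le> \<mu> * (w \<bullet> w)" by (intro mult_right_mono) auto
  with min[of w] show "smallest_nonzero_eigenvalue P * (w \<bullet> w) \<le> w \<bullet> (P *v w)"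
    unfolding smallest_nonzero_eigenvalue_def by linarith
qed

text \<open>Full row rank makes \<open>A\<^sup>T\<close> injective, so \<open>A A\<^sup>T\<close> is positive definite, all its eigenvalues are nonzero
  and the smallest of them bounds its quadratic form from below.\<close>

lemma full_row_rank_transpose_bound:
  fixes A :: "real^'n^'q"
  assumes "rank A = CARD('q)"
  shows "0 < smallest_nonzero_eigenvalue (A ** transpose A)"
    and "smallest_nonzero_eigenvalue (A ** transpose A) * (norm z)\<^sup>2 \<le> (norm (transpose A *v z))\<^sup>2"
proof -
  let ?P = "A ** transpose A"
  have form: "v \<bullet> (?P *v v) = (norm (transpose A *v v))\<^sup>2" for v
    by (simp add: inner_matrix_vector_mult power2_norm_eq_inner flip: matrix_vector_mul_assoc)
  have "inj ((*v) (transpose A))" using assms by (simp add: rank_transpose flip: full_rank_injective)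
  then have "transpose A *v v \<noteq> 0" if "v \<noteq> 0" for v
    using that by (metis injD matrix_vector_mult_0_right)
  then have pd: "0 < v \<bullet> (?P *v v)" if "v \<noteq> 0" for v using that unfolding form by simp
  have sym: "transpose ?P = ?P" by (simp add: matrix_transpose_mul)
  show "0 < smallest_nonzero_eigenvalue ?P" using sym pd by (rule smallest_nonzero_eigenvalue_pos_def)
  show "smallest_nonzero_eigenvalue ?P * (norm z)\<^sup>2 \<le> (norm (transpose A *v z))\<^sup>2"
    using smallest_nonzero_eigenvalue_pos_def(2)[OF sym pd, of z] unfolding form by (simp add: power2_norm_eq_inner)
qed

text \<open>Bounding the quadratic form of the positive semidefinite \<open>H\<close> bounds \<open>H\<close> itself: the form is nonnegative at
  \<open>M v - H v\<close>, and expanding this gives \<open>|H v|\<^sup>2 \<le> M (v \<bullet> H v) \<le> M\<^sup>2 |v|\<^sup>2\<close>.\<close>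

lemma norm_matrix_vector_mult_le_of_loewner_bounds:
  assumes psd: "pos_semidef H" and le: "H \<preceq> M *\<^sub>R mat 1" and M: "0 < M"
  shows "norm (H *v v) \<le> M * norm v"
proof -
  have sym: "transpose H = H" and nn: "\<And>u. 0 \<le> u \<bullet> (H *v u)" using psd by (auto simp: pos_semidef_def)
  have up: "u \<bullet> (H *v u) \<le> M * (u \<bullet> u)" for u
    using le unfolding loewner_le_def pos_semidef_def
    by (simp add: matrix_vector_mult_diff_rdistrib inner_diff_right flip: scaleR_matrix_vector_assoc)
  define h where "h = H *v v"
  have vh: "v \<bullet> (H *v h) = h \<bullet> h" unfolding inner_matrix_vector_mult sym by (simp add: h_def)
  have "0 \<le> (M *\<^sub>R v - h) \<bullet> (H *v (M *\<^sub>R v - h))" by (rule nn)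
  also have "\<dots> = M\<^sup>2 * (v \<bullet> h) - 2 * M * (h \<bullet> h) + h \<bullet> (H *v h)"
  proof -
    have "H *v (M *\<^sub>R v - h) = M *\<^sub>R h - H *v h"
      by (simp add: matrix_vector_mult_diff_distrib matrix_vector_mult_scaleR h_def)
    then show ?thesis
      by (simp only: inner_diff_left inner_diff_right inner_scaleR_left inner_scaleR_right vh)
        (simp add: power2_eq_square algebra_simps)
  qed
  also have "\<dots> \<le> M\<^sup>2 * (M * (v \<bullet> v)) - 2 * M * (h \<bullet> h) + M * (h \<bullet> h)"
    using up[of h] up[of v] M by (intro add_mono diff_mono mult_left_mono) (auto simp flip: h_def)
  finally have "M * (h \<bullet> h) \<le> M * (M\<^sup>2 * (v \<bullet> v))" by (simp add: algebra_simps power2_eq_square)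
  then have "(norm h)\<^sup>2 \<le> (M * norm v)\<^sup>2" using M by (simp add: power2_norm_eq_inner power_mult_distrib)
  then have "norm h \<le> M * norm v" by (rule power2_le_imp_le) (use M in simp)
  then show ?thesis by (simp add: h_def)
qed


section \<open>Saddle points of the Lagrangian\<close>

locale strongly_convex_lagrangian =
  fixes f :: "real^'n \<Rightarrow> real" and A :: "real^'n^'q" and b :: "real^'q" and m M L :: real
  assumes full_row_rank: "rank A = CARD('q)"
    and twice_diff: "twice_differentiable f"
    and m_pos: "0 < m" and m_le_M: "m \<le> M"
    and hessian_lower: "\<And>x. m *\<^sub>R mat 1 \<preceq> hessian f x"
    and hessian_upper: "\<And>x. hessian f x \<preceq> M *\<^sub>R mat 1"
    and L_pos: "0 < L"
    and hessian_lipschitz: "\<And>x y. matrix_norm (hessian f x - hessian f y) \<le> L * norm (x - y)"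
begin

lemma M_pos: "0 < M"
  using m_pos m_le_M by linarith

lemma f_differentiable: "f differentiable (at x)"
  using twice_diff by (simp add: twice_differentiable_def differentiable_on_def)

lemma f_has_derivative: "(f has_derivative (\<lambda>h. h \<bullet> gradient f x)) (at x)"
  using gderiv_gradient[OF f_differentiable] by (simp add: gderiv_def)

lemma gradient_has_derivative: "(gradient f has_derivative (\<lambda>h. hessian f x *v h)) (at x)"
  using twice_diff unfolding hessian_def twice_differentiable_def differentiable_on_def
  by (simp add: jacobian_works)

lemma f_along_line: "((\<lambda>s. f (x + s *\<^sub>R d)) has_real_derivative (gradient f (x + s *\<^sub>R d) \<bullet> d)) (at s)"
proof -
  have "((\<lambda>s. x + s *\<^sub>R d) has_derivative (\<lambda>h. h *\<^sub>R d)) (at s)"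
    by (auto intro!: derivative_eq_intros)
  from has_derivative_compose[OF this f_has_derivative]
  show ?thesis unfolding has_field_derivative_def
    by (simp add: inner_commute mult_commute_abs)
qed

lemma gradient_along_line:
  "((\<lambda>s. gradient f (x + s *\<^sub>R d)) has_vector_derivative (hessian f (x + s *\<^sub>R d) *v d)) (at s)"
proof -
  have "((\<lambda>s. x + s *\<^sub>R d) has_derivative (\<lambda>h. h *\<^sub>R d)) (at s)"
    by (auto intro!: derivative_eq_intros)
  from has_derivative_compose[OF this gradient_has_derivative]
  show ?thesis unfolding has_vector_derivative_def
    by (simp add: matrix_vector_mult_scaleR)
qed

lemma hessian_form_lower: "m * (norm v)\<^sup>2 \<le> v \<bullet> (hessian f x *v v)"
  using hessian_lower[of x] unfolding loewner_le_def pos_semidef_def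
  by (simp add: matrix_vector_mult_diff_rdistrib inner_diff_right power2_norm_eq_inner flip: scaleR_matrix_vector_assoc)

lemma hessian_pos_semidef: "pos_semidef (hessian f x)"
proof -
  have sym: "transpose (hessian f x - m *\<^sub>R mat 1) = hessian f x - m *\<^sub>R mat 1"
    using hessian_lower[of x] by (simp add: loewner_le_def pos_semidef_def)
  have "hessian f x $ j $ i = hessian f x $ i $ j" for i j
    using arg_cong[OF sym, of "\<lambda>B. B $ i $ j"] by (cases "i = j") (simp_all add: transpose_def mat_def)
  then have "transpose (hessian f x) = hessian f x"
    by (simp add: transpose_def vec_eq_iff)
  moreover have "0 \<le> v \<bullet> (hessian f x *v v)" for v
    using hessian_form_lower[of v x] m_pos by (smt (verit) mult_nonneg_nonneg zero_le_power2)
  ultimately show ?thesis by (simp add: pos_semidef_def)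
qed

lemma hessian_norm_le: "norm (hessian f x *v v) \<le> M * norm v"
  by (rule norm_matrix_vector_mult_le_of_loewner_bounds[OF hessian_pos_semidef hessian_upper M_pos])

lemma gradient_lipschitz: "norm (gradient f x - gradient f y) \<le> M * norm (x - y)"
proof (rule differentiable_bound[where f = "gradient f" and S = UNIV and f' = "\<lambda>u h. hessian f u *v h"])
  show "onorm ((*v) (hessian f u)) \<le> M" for u
    by (rule onorm_le) (rule hessian_norm_le)
  show "(gradient f has_derivative (*v) (hessian f u)) (at u)" for u
    by (rule gradient_has_derivative)
qed simp_all

lemma gradient_strongly_monotone: "m * (norm (x - y))\<^sup>2 \<le> (x - y) \<bullet> (gradient f x - gradient f y)"
proof -
  define d where "d = x - y"
  let ?\<phi> = "\<lambda>s. d \<bullet> gradient f (y + s *\<^sub>R d)"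
  have "(?\<phi> has_real_derivative d \<bullet> (hessian f (y + s *\<^sub>R d) *v d)) (at s)" for s
    using has_derivative_inner_right[OF gradient_along_line[unfolded has_vector_derivative_def], of d y d s]
    by (simp add: has_field_derivative_def mult_commute_abs)
  then obtain s where "?\<phi> 1 - ?\<phi> 0 = (1 - 0) * (d \<bullet> (hessian f (y + s *\<^sub>R d) *v d))"
    using MVT2[of 0 1 ?\<phi> "\<lambda>s. d \<bullet> (hessian f (y + s *\<^sub>R d) *v d)"] by auto
  then show ?thesis using hessian_form_lower[of d "y + s *\<^sub>R d"] by (simp add: d_def inner_diff_right)
qed

text \<open>Integrated form of strong monotonicity: along the segment, the difference of the two sides has a nonnegative
  derivative.\<close>

lemma f_quadratic_lower: "f x + gradient f x \<bullet> d + m / 2 * (norm d)\<^sup>2 \<le> f (x + d)"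
proof -
  let ?\<phi> = "\<lambda>s. f (x + s *\<^sub>R d) - s * (gradient f x \<bullet> d) - m / 2 * s\<^sup>2 * (norm d)\<^sup>2"
  let ?\<phi>' = "\<lambda>s. gradient f (x + s *\<^sub>R d) \<bullet> d - gradient f x \<bullet> d - m * s * (norm d)\<^sup>2"
  have "?\<phi> 0 \<le> ?\<phi> 1"
  proof (rule DERIV_nonneg_imp_nondecreasing[where f = ?\<phi>])
    fix s :: real assume s: "0 \<le> s" "s \<le> 1"
    have D: "(?\<phi> has_real_derivative ?\<phi>' s) (at s)"
      by (rule derivative_eq_intros f_along_line refl | simp)+
    have nn: "0 \<le> ?\<phi>' s"
    proof (cases "s = 0")
      case False
      have "m * (s\<^sup>2 * (norm d)\<^sup>2) \<le> s * (d \<bullet> (gradient f (x + s *\<^sub>R d) - gradient f x))"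
        using gradient_strongly_monotone[of "x + s *\<^sub>R d" x] by (simp add: power_mult_distrib)
      then have "s * (m * s * (norm d)\<^sup>2) \<le> s * (d \<bullet> (gradient f (x + s *\<^sub>R d) - gradient f x))"
        by (simp add: power2_eq_square mult_ac)
      then have "m * s * (norm d)\<^sup>2 \<le> d \<bullet> (gradient f (x + s *\<^sub>R d) - gradient f x)"
        using False s by simp
      then show ?thesis by (simp add: inner_diff_right inner_commute)
    qed simp
    show "\<exists>y. (?\<phi> has_real_derivative y) (at s) \<and> 0 \<le> y"
      using D nn by blast
  qed simp
  then show ?thesis by simp
qed

definition critical :: "real^'n \<Rightarrow> real^'q \<Rightarrow> bool" where
  "critical x z \<longleftrightarrow> gradient f x + transpose A *v z = 0 \<and> A *v x = b"

text \<open>Pairing the difference of the two stationarity equations with \<open>x - x'\<close> kills the multiplier term, because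
  \<open>x - x'\<close> lies in the kernel of \<open>A\<close>; strong monotonicity then forces \<open>x = x'\<close>.\<close>

lemma critical_unique:
  assumes "critical x z" "critical x' z'"
  shows "x = x' \<and> z = z'"
proof -
  have g: "gradient f x - gradient f x' = - (transpose A *v (z - z'))"
  proof -
    have "gradient f x = - (transpose A *v z)" "gradient f x' = - (transpose A *v z')"
      using assms by (simp_all add: critical_def eq_neg_iff_add_eq_0)
    then show ?thesis by (simp add: matrix_vector_mult_diff_distrib)
  qed
  have "A *v (x - x') = 0" using assms by (simp add: critical_def matrix_vector_mult_diff_distrib)
  then have "(x - x') \<bullet> (transpose A *v (z - z')) = 0"
    by (metis inner_commute inner_matrix_vector_mult inner_zero_right)
  then have "m * (norm (x - x'))\<^sup>2 \<le> 0"
    using gradient_strongly_monotone[of x x'] by (simp add: g)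
  then have x: "x = x'" using m_pos by (simp add: mult_le_0_iff)
  then have "smallest_nonzero_eigenvalue (A ** transpose A) * (norm (z - z'))\<^sup>2 \<le> 0"
    using full_row_rank_transpose_bound(2)[OF full_row_rank, of "z - z'"] g by simp
  then have "z = z'" using full_row_rank_transpose_bound(1)[OF full_row_rank] by (simp add: mult_le_0_iff)
  with x show ?thesis by simp
qed

text \<open>By the quadratic lower bound the sublevel sets of \<open>f\<close> are bounded, so the minimum over the affine
  constraint set is a minimum over a compact set.\<close>

lemma feasible_minimizer:
  obtains x where "A *v x = b" "\<And>y. A *v y = b \<Longrightarrow> f x \<le> f y"
proof -
  obtain x0 where x0: "A *v x0 = b"
    using full_row_rank unfolding full_rank_surjective by (metis surjD)
  let ?S = "{x. A *v x = b} \<inter> {x. f x \<le> f x0}"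
  have "x \<in> cball x0 (2 * norm (gradient f x0) / m)" if x: "f x \<le> f x0" for x
  proof -
    define d where "d = x - x0"
    have "gradient f x0 \<bullet> d + m / 2 * (norm d)\<^sup>2 \<le> 0" using f_quadratic_lower[of x0 d] x by (simp add: d_def)
    moreover have "- (gradient f x0 \<bullet> d) \<le> norm (gradient f x0) * norm d"
      by (rule abs_le_D2[OF Cauchy_Schwarz_ineq2])
    ultimately have "norm d * (m / 2 * norm d) \<le> norm d * norm (gradient f x0)"
      by (simp add: power2_eq_square algebra_simps)
    then have "norm d = 0 \<or> m / 2 * norm d \<le> norm (gradient f x0)"
      by (metis mult_le_cancel_left_pos norm_le_zero_iff norm_ge_zero order_less_le)
    then have "norm d \<le> 2 * norm (gradient f x0) / m" using m_pos by (auto simp: field_simps)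
    then show ?thesis by (simp add: d_def dist_norm norm_minus_commute)
  qed
  then have "bounded ?S" by (intro bounded_subset[OF bounded_cball]) auto
  moreover have contf: "continuous_on S f" for S
    using f_differentiable differentiable_imp_continuous_within continuous_at_imp_continuous_on by metis
  have "closed ?S"
  proof (intro closed_Int)
    show "closed {x. A *v x = b}"
      by (intro closed_Collect_eq continuous_intros linear_continuous_on matrix_vector_mul_bounded_linear)
    show "closed {x. f x \<le> f x0}" by (intro closed_Collect_le contf continuous_intros)
  qed
  ultimately have "compact ?S" by (simp add: compact_eq_bounded_closed)
  then obtain x where "x \<in> ?S" "\<forall>y\<in>?S. f x \<le> f y"
    using continuous_attains_inf[of ?S f] contf x0 by blast
  then have "A *v x = b" "\<And>y. A *v y = b \<Longrightarrow> f x \<le> f y" by force+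
  then show thesis by (rule that)
qed

text \<open>Lagrange multipliers for an affine constraint. At the constrained minimizer the gradient is orthogonal to
  the kernel of \<open>A\<close>. The multiplier \<open>z\<close> is chosen, by inverting \<open>A A\<^sup>T\<close>, so that the residual
  \<open>u = \<nabla>f(x) + A\<^sup>T z\<close> lies in that kernel; being also orthogonal to it, the residual vanishes.\<close>

lemma critical_exists:
  obtains x z where "critical x z"
proof -
  obtain x where x: "A *v x = b" and min: "\<And>y. A *v y = b \<Longrightarrow> f x \<le> f y"
    by (rule feasible_minimizer) (rule that; assumption)
  have tangent: "gradient f x \<bullet> v = 0" if v: "A *v v = 0" for v
  proof (rule DERIV_local_min)
    show "((\<lambda>s. f (x + s *\<^sub>R v)) has_real_derivative gradient f x \<bullet> v) (at 0)"
      using f_along_line[of x v 0] by simp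
    show "\<forall>s. \<bar>0 - s\<bar> < 1 \<longrightarrow> f (x + 0 *\<^sub>R v) \<le> f (x + s *\<^sub>R v)"
      using min v x by (simp add: matrix_vector_right_distrib matrix_vector_mult_scaleR)
  qed simp
  let ?P = "A ** transpose A"
  have "?P *v z \<noteq> 0" if "z \<noteq> 0" for z
  proof
    assume "?P *v z = 0"
    then have "(norm (transpose A *v z))\<^sup>2 = 0"
      by (metis inner_matrix_vector_mult inner_zero_right matrix_vector_mul_assoc power2_norm_eq_inner)
    then have "smallest_nonzero_eigenvalue ?P * (norm z)\<^sup>2 \<le> 0"
      using full_row_rank_transpose_bound(2)[OF full_row_rank, of z] by simp
    then show False using full_row_rank_transpose_bound(1)[OF full_row_rank] that by (simp add: mult_le_0_iff)
  qed
  then have "surj ((*v) ?P)"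
    by (metis full_rank_injective full_rank_surjective matrix_nonfull_linear_equations_eq)
  then obtain z where z: "?P *v z = - (A *v gradient f x)" by (metis surjD)
  define u where "u = gradient f x + transpose A *v z"
  have "A *v u = A *v gradient f x + ?P *v z"
    by (simp only: u_def matrix_vector_right_distrib matrix_vector_mul_assoc)
  then have Au: "A *v u = 0" unfolding z by simp
  have "u \<bullet> u = gradient f x \<bullet> u + z \<bullet> (A *v u)"
    by (subst (1) u_def) (simp add: inner_add_left inner_matrix_vector_mult)
  then have "u = 0" using tangent[OF Au] Au by simp
  then show thesis using that[of x z] x by (simp add: critical_def u_def)
qed

text \<open>Necessity tests the saddle inequalities with \<open>z + (A x - b)\<close> in the second argument and along the line
  through \<open>x\<close> in the direction of the \<open>x\<close>-gradient \<open>u\<close>. Sufficiency is convexity of \<open>f\<close> in \<open>x\<close>, the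
  function being constant in \<open>z\<close> when \<open>A x = b\<close>.\<close>

lemma Saddle_eq_critical:
  "Saddle (\<lambda>x z. f x + z \<bullet> (A *v x - b)) = {(x, z). critical x z}"
proof -
  have "critical x z" if s: "\<And>y w. f x + w \<bullet> (A *v x - b) \<le> f x + z \<bullet> (A *v x - b) \<and>
      f x + z \<bullet> (A *v x - b) \<le> f y + z \<bullet> (A *v y - b)" for x z
  proof -
    have "(z + (A *v x - b)) \<bullet> (A *v x - b) \<le> z \<bullet> (A *v x - b)" using s by fastforce
    then have "(norm (A *v x - b))\<^sup>2 \<le> 0" by (simp add: inner_add_left power2_norm_eq_inner)
    then have Ax: "A *v x = b" by simp
    define u where "u = gradient f x + transpose A *v z"
    have "u \<bullet> u = 0"
    proof (rule DERIV_local_min)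
      have "((\<lambda>s. f (x + s *\<^sub>R u) + s * (z \<bullet> (A *v u))) has_real_derivative gradient f x \<bullet> u + z \<bullet> (A *v u)) (at 0)"
        by (rule derivative_eq_intros f_along_line refl | simp)+
      moreover have "gradient f x \<bullet> u + z \<bullet> (A *v u) = u \<bullet> u"
        by (subst (3) u_def) (simp add: inner_add_left inner_matrix_vector_mult)
      ultimately show "((\<lambda>s. f (x + s *\<^sub>R u) + s * (z \<bullet> (A *v u))) has_real_derivative u \<bullet> u) (at 0)" by simp
      show "\<forall>s. \<bar>0 - s\<bar> < 1 \<longrightarrow> f (x + 0 *\<^sub>R u) + 0 * (z \<bullet> (A *v u)) \<le> f (x + s *\<^sub>R u) + s * (z \<bullet> (A *v u))"
      proof (intro allI impI)
        fix s show "f (x + 0 *\<^sub>R u) + 0 * (z \<bullet> (A *v u)) \<le> f (x + s *\<^sub>R u) + s * (z \<bullet> (A *v u))"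
          using conjunct2[OF s[of undefined "x + s *\<^sub>R u"]] Ax
          by (simp add: matrix_vector_right_distrib matrix_vector_mult_scaleR)
      qed
    qed simp
    then show ?thesis using Ax by (simp add: critical_def u_def)
  qed
  moreover have "f x + w \<bullet> (A *v x - b) \<le> f x + z \<bullet> (A *v x - b) \<and>
      f x + z \<bullet> (A *v x - b) \<le> f y + z \<bullet> (A *v y - b)" if c: "critical x z" for x y w z
  proof -
    have "gradient f x \<bullet> (y - x) + z \<bullet> (A *v (y - x)) = 0"
      using c by (simp add: critical_def inner_matrix_vector_mult flip: inner_add_left)
    then have "z \<bullet> (A *v y - b) = - (gradient f x \<bullet> (y - x))" "A *v x = b"
      using c by (simp_all add: critical_def matrix_vector_mult_diff_distrib)
    moreover have "0 \<le> m / 2 * (norm (y - x))\<^sup>2" using m_pos by simp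
    ultimately show ?thesis using f_quadratic_lower[of x "y - x"] by simp
  qed
  ultimately have "(\<forall>y w. f x + w \<bullet> (A *v x - b) \<le> f x + z \<bullet> (A *v x - b) \<and>
      f x + z \<bullet> (A *v x - b) \<le> f y + z \<bullet> (A *v y - b)) \<longleftrightarrow> critical x z" for x z by blast
  then show ?thesis unfolding Saddle_def by simp
qed

end


section \<open>Decrease of the Lyapunov function\<close>

text \<open>Products with \<open>A\<^sup>T\<close> are not to be turned into row vector times matrix, so that the norm and adjointness facts about them apply.\<close>

declare transpose_matrix_vector [simp del]

text \<open>The gap between the two sides is \<open>|2 u + v|\<^sup>2 / 2\<close>.\<close>

lemma half_norm_sq_le:
  fixes u v :: "'c::real_inner"
  shows "(norm v)\<^sup>2 / 2 - (norm u)\<^sup>2 \<le> (norm (u + v))\<^sup>2"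
proof -
  have "0 \<le> (norm (2 *\<^sub>R u + v))\<^sup>2 / 2" by simp
  also have "\<dots> = (norm (u + v))\<^sup>2 - (norm v)\<^sup>2 / 2 + (norm u)\<^sup>2"
    by (simp add: power2_norm_eq_inner inner_add_left inner_add_right inner_commute algebra_simps)
  finally show ?thesis by simp
qed

locale self_triggered_flow = strongly_convex_lagrangian f A b m M L
  for f :: "real^'n \<Rightarrow> real" and A :: "real^'n^'q" and b :: "real^'q" and m M L :: real +
  fixes \<beta>1 :: real and xs :: "real^'n" and zs :: "real^'q"
  assumes \<beta>1_pos: "0 < \<beta>1" and crit: "critical xs zs"
begin

abbreviation F :: "real^'n \<Rightarrow> real^'q \<Rightarrow> real" where
  "F \<equiv> \<lambda>x z. f x + z \<bullet> (A *v x - b)"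

abbreviation gx :: "real^'n \<Rightarrow> real^'q \<Rightarrow> real^'n" where
  "gx x z \<equiv> gradient f x + transpose A *v z"

abbreviation gz :: "real^'n \<Rightarrow> real^'q" where
  "gz x \<equiv> A *v x - b"

abbreviation a :: real where "a \<equiv> matrix_norm A"
abbreviation \<beta>2 :: real where "\<beta>2 \<equiv> beta2 \<beta>1 m M"
abbreviation \<rho> :: real where "\<rho> \<equiv> lambda_tilde \<beta>1 m A"
abbreviation \<tau> :: "real^'n \<Rightarrow> real^'q \<Rightarrow> real" where "\<tau> \<equiv> trigger_step F A \<beta>1 m M L"

definition dist_sq :: "real^'n \<Rightarrow> real^'q \<Rightarrow> real" where
  "dist_sq x z = (norm (x - xs))\<^sup>2 + (norm (z - zs))\<^sup>2"

definition lyap :: "real^'n \<Rightarrow> real^'q \<Rightarrow> real" where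
  "lyap x z = \<beta>1 / 2 * ((norm (gx x z))\<^sup>2 + (norm (gz x))\<^sup>2) + \<beta>2 / 2 * dist_sq x z"

text \<open>The derivative of \<open>lyap\<close> along the continuous flow \<open>(- gx, gz)\<close>, after cancellation of the terms
  that couple \<open>gx\<close> and \<open>gz\<close> through \<open>A\<close>.\<close>

definition lyap_rate :: "real^'n \<Rightarrow> real^'q \<Rightarrow> real" where
  "lyap_rate x z = - \<beta>1 * (gx x z \<bullet> (hessian f x *v gx x z))
     + \<beta>2 * ((z - zs) \<bullet> gz x - (x - xs) \<bullet> gx x z)"

text \<open>Bounds the rate at which the derivative of \<open>lyap\<close> along the ray in the direction of the flow rises above
  its initial value, per unit of squared speed. It depends on the state through \<open>gx\<close>, because the Hessian of \<open>lyap\<close>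
  would involve third derivatives of \<open>f\<close> multiplied by \<open>gx\<close>.\<close>

definition curvature :: "real^'n \<Rightarrow> real^'q \<Rightarrow> real" where
  "curvature x z = \<beta>1 * (M\<^sup>2 + L * norm (gx x z) + M * a + a\<^sup>2) + \<beta>2"

lemma a_nonneg: "0 \<le> a"
  by (rule matrix_norm_nonneg)

lemma \<beta>2_pos: "0 < \<beta>2"
  using \<beta>1_pos m_pos M_pos by (simp add: beta2_def)

lemma \<rho>_pos: "0 < \<rho>"
  using \<beta>1_pos m_pos full_row_rank_transpose_bound(1)[OF full_row_rank]
  by (simp add: lambda_tilde_def lambda_m_def)

lemma dist_sq_nonneg: "0 \<le> dist_sq x z"
  by (simp add: dist_sq_def)

lemma lyap_nonneg: "0 \<le> lyap x z"
  using \<beta>1_pos \<beta>2_pos dist_sq_nonneg[of x z] by (simp add: lyap_def)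

lemma gx_eq: "gx x z = (gradient f x - gradient f xs) + transpose A *v (z - zs)"
proof -
  have "gradient f xs = - (transpose A *v zs)"
    using crit by (simp add: critical_def eq_neg_iff_add_eq_0)
  then show ?thesis by (simp add: matrix_vector_mult_diff_distrib)
qed

lemma gz_eq: "gz x = A *v (x - xs)"
  using crit by (simp add: critical_def matrix_vector_mult_diff_distrib)

text \<open>Two sources of dissipation are balanced. The distance term of \<open>lyap\<close> dissipates at least \<open>\<beta>2 m X\<close> with
  \<open>X = |x - xs|\<^sup>2\<close>. The gradient term dissipates at least \<open>\<beta>1 m |gx|\<^sup>2\<close>, and \<open>gx\<close> is \<open>A\<^sup>T (z - zs)\<close> up to a
  vector of squared norm at most \<open>M\<^sup>2 X\<close>, so half of \<open>N = |A\<^sup>T (z - zs)|\<^sup>2\<close> survives. The loss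
  \<open>\<beta>1 m M\<^sup>2 X\<close> is absorbed by \<open>\<beta>2 m = 4 \<beta>1 M\<^sup>4 / m\<close>, leaving at least \<open>\<beta>1 m\<^sup>3 X\<close>; these two remainders are
  the entries of \<^const>\<open>lambda_m\<close>. The smallest eigenvalue of \<open>A A\<^sup>T\<close> turns \<open>N\<close> into \<open>|z - zs|\<^sup>2\<close>.\<close>

lemma lyap_rate_le: "lyap_rate x z \<le> - \<rho> * dist_sq x z"
proof -
  define dx dz where "dx = x - xs" and "dz = z - zs"
  define dg where "dg = gradient f x - gradient f xs"
  define X Z N where "X = (norm dx)\<^sup>2" and "Z = (norm dz)\<^sup>2" and "N = (norm (transpose A *v dz))\<^sup>2"
  let ?s = "smallest_nonzero_eigenvalue (A ** transpose A)"
  have g: "gx x z = dg + transpose A *v dz" by (simp only: gx_eq dg_def dz_def)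
  have "dx \<bullet> (transpose A *v dz) = dz \<bullet> (A *v dx)"
    by (simp only: inner_matrix_vector_mult[of dz A dx] inner_commute[of dx])
  then have "dx \<bullet> gx x z - dz \<bullet> gz x = dx \<bullet> dg"
    unfolding g gz_eq by (simp add: inner_add_right flip: dx_def)
  then have dissip: "dz \<bullet> gz x - dx \<bullet> gx x z \<le> - (m * X)"
    using gradient_strongly_monotone[of x xs] by (simp add: dx_def dg_def X_def)
  have "(norm dg)\<^sup>2 \<le> (M * norm dx)\<^sup>2"
    by (rule power_mono) (simp_all add: dg_def dx_def gradient_lipschitz)
  then have dgX: "(norm dg)\<^sup>2 \<le> M\<^sup>2 * X" by (simp add: X_def power_mult_distrib)
  have "N / 2 - M\<^sup>2 * X \<le> (norm (gx x z))\<^sup>2"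
    using half_norm_sq_le[of "transpose A *v dz" dg] dgX unfolding g N_def by linarith
  then have "m * (N / 2 - M\<^sup>2 * X) \<le> gx x z \<bullet> (hessian f x *v gx x z)"
    using hessian_form_lower[of "gx x z" x] m_pos by (meson mult_left_mono order_trans less_imp_le)
  then have "lyap_rate x z \<le> - \<beta>1 * (m * (N / 2 - M\<^sup>2 * X)) + \<beta>2 * (- (m * X))"
    unfolding lyap_rate_def using dissip \<beta>1_pos \<beta>2_pos
    by (intro add_mono mult_left_mono mult_left_mono_neg) (auto simp: dx_def dz_def)
  also have "\<dots> = - (1/2 * \<beta>1 * m) * N - (\<beta>2 * m - \<beta>1 * m * M\<^sup>2) * X" by (simp add: algebra_simps)
  also have "\<dots> \<le> - (1/2 * \<beta>1 * m) * N - (\<beta>1 * m ^ 3) * X"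
  proof -
    have sq: "m\<^sup>2 \<le> M\<^sup>2" using m_pos m_le_M by (intro power_mono) auto
    have "m\<^sup>2 * M\<^sup>2 + m\<^sup>2 * m\<^sup>2 \<le> M\<^sup>2 * M\<^sup>2 + M\<^sup>2 * M\<^sup>2" using sq by (intro add_mono mult_mono) auto
    also have "\<dots> = 2 * M ^ 4" by (simp flip: power_add)
    also have "\<dots> \<le> 4 * M ^ 4" using M_pos by simp
    finally have "\<beta>1 / m * (m\<^sup>2 * M\<^sup>2 + m\<^sup>2 * m\<^sup>2) \<le> \<beta>1 / m * (4 * M ^ 4)"
      using \<beta>1_pos m_pos by (intro mult_left_mono) auto
    moreover have "\<beta>1 / m * (m\<^sup>2 * M\<^sup>2 + m\<^sup>2 * m\<^sup>2) = \<beta>1 * m * M\<^sup>2 + \<beta>1 * m ^ 3"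
      "\<beta>1 / m * (4 * M ^ 4) = \<beta>2 * m"
      using m_pos by (simp_all add: beta2_def field_simps power2_eq_square power3_eq_cube)
    ultimately have "\<beta>1 * m ^ 3 \<le> \<beta>2 * m - \<beta>1 * m * M\<^sup>2" by simp
    then have "\<beta>1 * m ^ 3 * X \<le> (\<beta>2 * m - \<beta>1 * m * M\<^sup>2) * X" by (intro mult_right_mono) (auto simp: X_def)
    then show ?thesis by simp
  qed
  also have "\<dots> \<le> - lambda_m \<beta>1 m * (N + X)"
  proof -
    have "lambda_m \<beta>1 m * N \<le> (1/2 * \<beta>1 * m) * N" "lambda_m \<beta>1 m * X \<le> (\<beta>1 * m ^ 3) * X"
      by (intro mult_right_mono; simp add: lambda_m_def N_def X_def)+
    then show ?thesis by (simp add: distrib_left)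
  qed
  also have "\<dots> \<le> - lambda_m \<beta>1 m * (min 1 ?s * (X + Z))"
  proof -
    have "min 1 ?s * X \<le> 1 * X" "min 1 ?s * Z \<le> ?s * Z"
      by (intro mult_right_mono; simp add: X_def Z_def)+
    moreover have "?s * Z \<le> N"
      unfolding Z_def N_def by (rule full_row_rank_transpose_bound(2)[OF full_row_rank])
    ultimately have "min 1 ?s * (X + Z) \<le> N + X" by (simp only: distrib_left)
    moreover have "0 \<le> lambda_m \<beta>1 m" using \<beta>1_pos m_pos by (simp add: lambda_m_def)
    ultimately show ?thesis by (simp add: mult_left_mono)
  qed
  finally show ?thesis by (simp add: lambda_tilde_def dist_sq_def X_def Z_def dx_def dz_def)
qed

text \<open>Both partial gradients vanish at the saddle point and are Lipschitz, so the speed is controlled by the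
  distance; the factor 3 collects two from \<open>(p + q)\<^sup>2 \<le> 2 p\<^sup>2 + 2 q\<^sup>2\<close> and one from \<open>gz\<close>.\<close>

lemma speed_sq_le: "(norm (gx x z))\<^sup>2 + (norm (gz x))\<^sup>2 \<le> 3 * (M\<^sup>2 + a\<^sup>2) * dist_sq x z"
proof -
  define X Z where "X = norm (x - xs)" and "Z = norm (z - zs)"
  have "norm (gx x z) \<le> M * X + a * Z"
    unfolding gx_eq X_def Z_def
    by (intro norm_triangle_le add_mono gradient_lipschitz norm_transpose_mult_le)
  then have "(norm (gx x z))\<^sup>2 \<le> (M * X + a * Z)\<^sup>2" by (intro power_mono) auto
  also have "\<dots> \<le> 2 * (M * X)\<^sup>2 + 2 * (a * Z)\<^sup>2"
    using zero_le_power2[of "M * X - a * Z"] by (simp add: power2_sum power2_diff)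
  finally have g: "(norm (gx x z))\<^sup>2 \<le> 2 * (M\<^sup>2 * X\<^sup>2) + 2 * (a\<^sup>2 * Z\<^sup>2)" by (simp add: power_mult_distrib)
  have "norm (gz x) \<le> a * X" unfolding gz_eq X_def by (rule norm_matrix_vector_mult_le)
  then have "(norm (gz x))\<^sup>2 \<le> (a * X)\<^sup>2" by (intro power_mono) auto
  then have w: "(norm (gz x))\<^sup>2 \<le> a\<^sup>2 * X\<^sup>2" by (simp add: power_mult_distrib)
  define p q r s where "p = M\<^sup>2 * X\<^sup>2" and "q = M\<^sup>2 * Z\<^sup>2" and "r = a\<^sup>2 * X\<^sup>2" and "s = a\<^sup>2 * Z\<^sup>2"
  have "0 \<le> p" "0 \<le> q" "0 \<le> r" "0 \<le> s" by (simp_all add: p_def q_def r_def s_def)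
  moreover have "(norm (gx x z))\<^sup>2 \<le> 2 * p + 2 * s" "(norm (gz x))\<^sup>2 \<le> r"
    using g w by (simp_all add: p_def q_def r_def s_def)
  ultimately have "2 * p + 2 * s + r \<le> 3 * (p + q + r + s)"
    "(norm (gx x z))\<^sup>2 + (norm (gz x))\<^sup>2 \<le> 2 * p + 2 * s + r"
    by (simp_all add: add_mono)
  then have "(norm (gx x z))\<^sup>2 + (norm (gz x))\<^sup>2 \<le> 3 * (p + q + r + s)" by (rule order_trans[rotated])
  also have "\<dots> = 3 * (M\<^sup>2 * X\<^sup>2 + M\<^sup>2 * Z\<^sup>2 + a\<^sup>2 * X\<^sup>2 + a\<^sup>2 * Z\<^sup>2)"
    by (simp add: p_def q_def r_def s_def)
  also have "\<dots> = 3 * (M\<^sup>2 + a\<^sup>2) * dist_sq x z" by (simp add: dist_sq_def X_def Z_def algebra_simps)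
  finally show ?thesis .
qed

text \<open>Subtracting the claimed quadratic from \<open>lyap\<close> along the ray gives a nonincreasing function. Its derivative
  compares \<open>D s\<close>, the derivative of \<open>lyap\<close> at parameter \<open>s\<close>, with its value at \<open>0\<close>. With \<open>e\<close> the change of
  \<open>gx\<close> along the ray, the difference splits into the work of \<open>e\<close> (\<open>t1\<close>), the change of the Hessian, bounded by its
  Lipschitz constant (\<open>t2\<close>), the change of \<open>gz\<close> (\<open>t3\<close>), and the exactly quadratic distance term.\<close>

lemma lyap_along_step:
  assumes t: "0 \<le> t"
  shows "lyap (x - t *\<^sub>R gx x z) (z + t *\<^sub>R gz x)
    \<le> lyap x z + t * lyap_rate x z + t\<^sup>2 / 2 * curvature x z * ((norm (gx x z))\<^sup>2 + (norm (gz x))\<^sup>2)"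
proof -
  define g w where "g = gx x z" and "w = gz x"
  define X where "X s = x - s *\<^sub>R g" for s
  define Z where "Z s = z + s *\<^sub>R w" for s
  define H where "H s = hessian f (X s)" for s
  define gs ws where "gs s = gx (X s) (Z s)" and "ws s = gz (X s)" for s
  define K where "K = curvature x z * ((norm g)\<^sup>2 + (norm w)\<^sup>2)"
  let ?V = "\<lambda>s. lyap (X s) (Z s) - s * lyap_rate x z - s\<^sup>2 / 2 * K"
  define D where "D s = \<beta>1 * (gs s \<bullet> (transpose A *v w - H s *v g) - ws s \<bullet> (A *v g))
    + \<beta>2 * ((Z s - zs) \<bullet> w - (X s - xs) \<bullet> g)" for s
  have dX: "(X has_vector_derivative - g) (at s)" and dZ: "(Z has_vector_derivative w) (at s)" for s
    unfolding X_def Z_def by (auto intro!: derivative_eq_intros)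
  have dgs: "(gs has_vector_derivative (transpose A *v w - H s *v g)) (at s)" for s
  proof -
    have "((\<lambda>s. gradient f (X s)) has_vector_derivative - (H s *v g)) (at s)"
      using gradient_along_line[of x "- g" s] by (simp add: X_def H_def matrix_vector_mult_uminus)
    moreover have "((\<lambda>s. transpose A *v Z s) has_vector_derivative transpose A *v w) (at s)"
      by (rule bounded_linear.has_vector_derivative[OF matrix_vector_mul_bounded_linear dZ])
    ultimately show ?thesis
      unfolding gs_def using has_vector_derivative_add by fastforce
  qed
  have dws: "(ws has_vector_derivative - (A *v g)) (at s)" for s
  proof -
    have "((\<lambda>s. A *v X s) has_vector_derivative A *v (- g)) (at s)"
      by (rule bounded_linear.has_vector_derivative[OF matrix_vector_mul_bounded_linear dX])
    then show ?thesis unfolding ws_def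
      by (auto intro!: derivative_eq_intros simp: matrix_vector_mult_uminus)
  qed
  have dsq: "((\<lambda>s. (norm (u s))\<^sup>2) has_real_derivative 2 * (u s \<bullet> u')) (at s)"
    if "(u has_vector_derivative u') (at s)" for u :: "real \<Rightarrow> 'c::real_inner" and u' s
  proof -
    have "((\<lambda>s. u s \<bullet> u s) has_derivative (\<lambda>h. u s \<bullet> (h *\<^sub>R u') + (h *\<^sub>R u') \<bullet> u s)) (at s)"
      using that unfolding has_vector_derivative_def by (intro has_derivative_inner)
    then show ?thesis
      unfolding has_field_derivative_def power2_norm_eq_inner
      by (rule has_derivative_eq_rhs) (simp add: fun_eq_iff inner_commute)
  qed
  have dlyap: "((\<lambda>s. lyap (X s) (Z s)) has_real_derivative D s) (at s)" for s
  proof -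
    have dx: "((\<lambda>s. (norm (X s - xs))\<^sup>2) has_real_derivative 2 * ((X s - xs) \<bullet> (- g))) (at s)"
      by (rule dsq) (auto intro!: derivative_eq_intros dX)
    have dz: "((\<lambda>s. (norm (Z s - zs))\<^sup>2) has_real_derivative 2 * ((Z s - zs) \<bullet> w)) (at s)"
      by (rule dsq) (auto intro!: derivative_eq_intros dZ)
    have "((\<lambda>s. \<beta>1 / 2 * ((norm (gs s))\<^sup>2 + (norm (ws s))\<^sup>2) + \<beta>2 / 2 * ((norm (X s - xs))\<^sup>2 + (norm (Z s - zs))\<^sup>2))
        has_real_derivative
          \<beta>1 / 2 * (2 * (gs s \<bullet> (transpose A *v w - H s *v g)) + 2 * (ws s \<bullet> - (A *v g)))
          + \<beta>2 / 2 * (2 * ((X s - xs) \<bullet> (- g)) + 2 * ((Z s - zs) \<bullet> w))) (at s)"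
      by (intro DERIV_add DERIV_cmult dsq[OF dgs] dsq[OF dws] dx dz)
    then show ?thesis
      unfolding lyap_def dist_sq_def gs_def[symmetric] ws_def[symmetric]
      by (rule DERIV_cong) (simp add: D_def algebra_simps)
  qed
  have D0: "lyap_rate x z = - \<beta>1 * (g \<bullet> (H 0 *v g)) + \<beta>2 * ((z - zs) \<bullet> w - (x - xs) \<bullet> g)"
    by (simp add: lyap_rate_def g_def w_def H_def X_def)
  have DK: "D s \<le> lyap_rate x z + s * K" if s: "0 \<le> s" for s
  proof -
    define e where "e = gs s - g"
    define G W where "G = norm g" and "W = norm w"
    have GW: "0 \<le> G" "0 \<le> W" by (simp_all add: G_def W_def)
    have ws: "ws s = w - s *\<^sub>R (A *v g)"
      by (simp add: ws_def w_def X_def matrix_vector_mult_diff_distrib matrix_vector_mult_scaleR algebra_simps)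
    have e: "norm e \<le> s * (M * G + a * W)"
    proof -
      have "e = (gradient f (X s) - gradient f x) + s *\<^sub>R (transpose A *v w)"
        by (simp add: e_def gs_def g_def Z_def matrix_vector_right_distrib matrix_vector_mult_scaleR)
      moreover have "norm (gradient f (X s) - gradient f x) \<le> M * (s * G)"
        using gradient_lipschitz[of "X s" x] s by (simp add: X_def G_def)
      moreover have "norm (s *\<^sub>R (transpose A *v w)) \<le> s * (a * W)"
        using norm_transpose_mult_le[of A w] s by (simp add: W_def mult_left_mono)
      ultimately have "norm e \<le> M * (s * G) + s * (a * W)" by (metis norm_triangle_le add_mono)
      then show ?thesis by (simp add: algebra_simps)
    qed
    have t1: "e \<bullet> (transpose A *v w - H s *v g) \<le> s * (M * G + a * W) * (a * W + M * G)"
    proof -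
      have "norm (transpose A *v w - H s *v g) \<le> a * W + M * G"
        using norm_transpose_mult_le[of A w] hessian_norm_le[of "X s" g] unfolding H_def G_def W_def
        by (intro norm_triangle_le_diff add_mono)
      with e have "norm e * norm (transpose A *v w - H s *v g) \<le> s * (M * G + a * W) * (a * W + M * G)"
        using s GW a_nonneg M_pos by (intro mult_mono) auto
      then show ?thesis using norm_cauchy_schwarz order_trans by blast
    qed
    have t2: "- (g \<bullet> (H s *v g)) \<le> - (g \<bullet> (H 0 *v g)) + s * (L * G * G\<^sup>2)"
    proof -
      have "norm ((H s - H 0) *v g) \<le> matrix_norm (H s - H 0) * G"
        unfolding G_def by (rule norm_matrix_vector_mult_le)
      also have "\<dots> \<le> (L * (s * G)) * G"
        using hessian_lipschitz[of "X s" "X 0"] s GW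
        by (intro mult_right_mono) (auto simp: H_def X_def G_def)
      finally have "G * norm ((H s - H 0) *v g) \<le> G * ((L * (s * G)) * G)" using GW by (intro mult_left_mono)
      moreover have "- (g \<bullet> ((H s - H 0) *v g)) \<le> G * norm ((H s - H 0) *v g)"
        unfolding G_def by (rule abs_le_D2[OF Cauchy_Schwarz_ineq2])
      ultimately have "- (g \<bullet> ((H s - H 0) *v g)) \<le> s * (L * G * G\<^sup>2)" by (simp add: power2_eq_square mult_ac)
      then show ?thesis by (simp add: matrix_vector_mult_diff_rdistrib inner_diff_right)
    qed
    have t3: "s * ((A *v g) \<bullet> (A *v g)) \<le> s * (a\<^sup>2 * G\<^sup>2)"
    proof -
      have "(norm (A *v g))\<^sup>2 \<le> (a * G)\<^sup>2" unfolding G_def by (intro power_mono norm_matrix_vector_mult_le) simp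
      then show ?thesis using s by (simp add: power2_norm_eq_inner power_mult_distrib mult_left_mono)
    qed
    (* The two coupling terms that remain in D s at s = 0 are equal and enter with opposite signs. *)
    have cross: "g \<bullet> (transpose A *v w) = w \<bullet> (A *v g)"
      by (simp only: inner_matrix_vector_mult[of w A g] inner_commute[of g])
    have "D s = \<beta>1 * (e \<bullet> (transpose A *v w - H s *v g) + - (g \<bullet> (H s *v g)) + s * ((A *v g) \<bullet> (A *v g)))
        + \<beta>2 * ((z - zs) \<bullet> w - (x - xs) \<bullet> g + s * (W\<^sup>2 + G\<^sup>2))"
    proof -
      have "gs s = g + e" by (simp add: e_def)
      then have i: "gs s \<bullet> (transpose A *v w - H s *v g) - ws s \<bullet> (A *v g)
         = e \<bullet> (transpose A *v w - H s *v g) + - (g \<bullet> (H s *v g)) + s * ((A *v g) \<bullet> (A *v g))"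
        unfolding ws by (simp add: inner_add_left inner_diff_right inner_diff_left cross)
      have ii: "(Z s - zs) \<bullet> w - (X s - xs) \<bullet> g = (z - zs) \<bullet> w - (x - xs) \<bullet> g + s * (W\<^sup>2 + G\<^sup>2)"
        by (simp add: Z_def X_def W_def G_def power2_norm_eq_inner inner_diff_left inner_add_left algebra_simps)
      show ?thesis unfolding D_def i ii ..
    qed
    also have "\<dots> \<le> \<beta>1 * (s * (M * G + a * W) * (a * W + M * G) + (- (g \<bullet> (H 0 *v g)) + s * (L * G * G\<^sup>2)) + s * (a\<^sup>2 * G\<^sup>2))
        + \<beta>2 * ((z - zs) \<bullet> w - (x - xs) \<bullet> g + s * (W\<^sup>2 + G\<^sup>2))"
      by (intro t1 t2 t3 add_right_mono mult_left_mono add_mono less_imp_le[OF \<beta>1_pos])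
    also have "\<dots> = lyap_rate x z
        + s * (\<beta>1 * ((M * G + a * W)\<^sup>2 + L * G * G\<^sup>2 + a\<^sup>2 * G\<^sup>2) + \<beta>2 * (G\<^sup>2 + W\<^sup>2))"
      unfolding D0 by (simp add: algebra_simps power2_eq_square)
    also have "\<dots> \<le> lyap_rate x z + s * K"
    proof -
      have "2 * (M * a * (G * W)) \<le> M * a * (G\<^sup>2 + W\<^sup>2)"
        using mult_left_mono[OF sum_squares_bound[of G W], of "M * a"] M_pos a_nonneg by (simp add: mult_ac)
      moreover have "0 \<le> M\<^sup>2 * W\<^sup>2 + L * G * W\<^sup>2" using L_pos GW by simp
      moreover have "(M\<^sup>2 + L * G + M * a + a\<^sup>2) * (G\<^sup>2 + W\<^sup>2) - ((M * G + a * W)\<^sup>2 + L * G * G\<^sup>2 + a\<^sup>2 * G\<^sup>2)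
          = (M * a * (G\<^sup>2 + W\<^sup>2) - 2 * (M * a * (G * W))) + (M\<^sup>2 * W\<^sup>2 + L * G * W\<^sup>2)"
        by (simp add: power2_eq_square algebra_simps)
      ultimately have "(M * G + a * W)\<^sup>2 + L * G * G\<^sup>2 + a\<^sup>2 * G\<^sup>2
          \<le> (M\<^sup>2 + L * G + M * a + a\<^sup>2) * (G\<^sup>2 + W\<^sup>2)" by linarith
      then have "\<beta>1 * ((M * G + a * W)\<^sup>2 + L * G * G\<^sup>2 + a\<^sup>2 * G\<^sup>2)
          \<le> \<beta>1 * ((M\<^sup>2 + L * G + M * a + a\<^sup>2) * (G\<^sup>2 + W\<^sup>2))" using \<beta>1_pos by (intro mult_left_mono) auto
      then have "\<beta>1 * ((M * G + a * W)\<^sup>2 + L * G * G\<^sup>2 + a\<^sup>2 * G\<^sup>2) + \<beta>2 * (G\<^sup>2 + W\<^sup>2) \<le> K"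
        by (simp add: K_def curvature_def G_def W_def g_def distrib_right mult.assoc)
      then show ?thesis using s by (intro add_left_mono mult_left_mono)
    qed
    finally show ?thesis .
  qed
  have "?V t \<le> ?V 0"
  proof (rule DERIV_nonpos_imp_nonincreasing[where f = ?V])
    fix s assume s: "0 \<le> s" "s \<le> t"
    have "(?V has_real_derivative D s - lyap_rate x z - s * K) (at s)"
      by (rule derivative_eq_intros dlyap refl | simp)+
    then show "\<exists>y. (?V has_real_derivative y) (at s) \<and> y \<le> 0"
      using DK[OF s(1)] by (intro exI[of _ "D s - lyap_rate x z - s * K"]) auto
  qed (rule t)
  then show ?thesis by (simp add: X_def Z_def K_def g_def w_def mult.assoc)
qed

lemma grad_x_F: "grad_x F x z = gx x z"
  by (rule grad_x_lagrangian[OF f_differentiable])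

lemma grad_z_F: "grad_z F x z = gz x"
  by (rule grad_z_lagrangian)

text \<open>Since \<open>M\<close> is at most \<^const>\<open>xi2\<close>, the curvature is at most a sum of four terms whose squares add up to
  \<open>xi\<^sup>2 / 3\<close>. Cauchy-Schwarz for four terms gives the factor \<open>2 / sqrt 3\<close>, which is less than \<open>3/2\<close>. A factor
  below 2 is what the decrease over a full step requires.\<close>

lemma curvature_le_xi: "curvature x z \<le> 3 / 2 * xi F A \<beta>1 m M L x z"
proof -
  define p q r where "p = \<beta>1 * xi1 F A M L x z" and "q = \<beta>1 * a\<^sup>2" and "r = \<beta>1 * (a * xi2 M A)"
  have xi2: "M \<le> xi2 M A" by (simp add: xi2_def)
  have "M * M \<le> M * xi2 M A" "a * M \<le> a * xi2 M A"
    using xi2 M_pos a_nonneg by (intro mult_left_mono; simp)+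
  then have "M\<^sup>2 + L * norm (gx x z) + M * a + a\<^sup>2 \<le> xi1 F A M L x z + a\<^sup>2 + a * xi2 M A"
    by (simp add: xi1_def grad_x_F power2_eq_square mult.commute)
  then have "\<beta>1 * (M\<^sup>2 + L * norm (gx x z) + M * a + a\<^sup>2) \<le> \<beta>1 * (xi1 F A M L x z + a\<^sup>2 + a * xi2 M A)"
    using \<beta>1_pos by (intro mult_left_mono) auto
  then have "curvature x z \<le> p + q + r + \<beta>2"
    by (simp add: curvature_def p_def q_def r_def distrib_left)
  also have "\<dots> \<le> sqrt (4 * (p\<^sup>2 + q\<^sup>2 + r\<^sup>2 + \<beta>2\<^sup>2))"
  proof (rule real_le_rsqrt)
    have "4 * (p\<^sup>2 + q\<^sup>2 + r\<^sup>2 + \<beta>2\<^sup>2) - (p + q + r + \<beta>2)\<^sup>2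
      = (p - q)\<^sup>2 + (p - r)\<^sup>2 + (p - \<beta>2)\<^sup>2 + (q - r)\<^sup>2 + (q - \<beta>2)\<^sup>2 + (r - \<beta>2)\<^sup>2"
      by (simp add: power2_eq_square algebra_simps)
    also have "\<dots> \<ge> 0" by simp
    finally show "(p + q + r + \<beta>2)\<^sup>2 \<le> 4 * (p\<^sup>2 + q\<^sup>2 + r\<^sup>2 + \<beta>2\<^sup>2)" by simp
  qed
  also have "\<dots> \<le> 3 / 2 * (sqrt 3 * sqrt (p\<^sup>2 + q\<^sup>2 + r\<^sup>2 + \<beta>2\<^sup>2))"
  proof -
    (* 27/4 is the square of 3/2 times the square root of 3. *)
    have "3 / 2 * (sqrt 3 * sqrt (p\<^sup>2 + q\<^sup>2 + r\<^sup>2 + \<beta>2\<^sup>2)) = sqrt (27 / 4 * (p\<^sup>2 + q\<^sup>2 + r\<^sup>2 + \<beta>2\<^sup>2))"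
      by (rule real_sqrt_unique[symmetric]) (auto simp: power_mult_distrib power_divide)
    moreover have "sqrt (4 * (p\<^sup>2 + q\<^sup>2 + r\<^sup>2 + \<beta>2\<^sup>2)) \<le> sqrt (27 / 4 * (p\<^sup>2 + q\<^sup>2 + r\<^sup>2 + \<beta>2\<^sup>2))"
      by (intro real_sqrt_le_mono mult_right_mono) auto
    ultimately show ?thesis by simp
  qed
  also have "p\<^sup>2 + q\<^sup>2 + r\<^sup>2 + \<beta>2\<^sup>2 = \<beta>1\<^sup>2 * ((xi1 F A M L x z)\<^sup>2 + a ^ 4 + a\<^sup>2 * (xi2 M A)\<^sup>2) + \<beta>2\<^sup>2"
    by (simp add: p_def q_def r_def power_mult_distrib distrib_left flip: power_mult)
  finally show ?thesis unfolding xi_def .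
qed

lemma xi_radicand_pos: "0 < \<beta>1\<^sup>2 * (y\<^sup>2 + a ^ 4 + a\<^sup>2 * (xi2 M A)\<^sup>2) + \<beta>2\<^sup>2"
proof -
  have "0 < \<beta>2\<^sup>2" using \<beta>2_pos by simp
  moreover have "0 \<le> \<beta>1\<^sup>2 * (y\<^sup>2 + a ^ 4 + a\<^sup>2 * (xi2 M A)\<^sup>2)" by simp
  ultimately show ?thesis by (rule add_nonneg_pos[rotated])
qed

lemma xi_pos: "0 < xi F A \<beta>1 m M L x z"
  unfolding xi_def using xi_radicand_pos by simp

lemma gain_pos: "0 < 3 * (M\<^sup>2 + a\<^sup>2)"
  using M_pos by (simp add: add_pos_nonneg)

lemma \<tau>_pos: "0 < \<tau> x z"
  unfolding trigger_step_def by (rule divide_pos_pos[OF \<rho>_pos mult_pos_pos[OF gain_pos xi_pos]])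

text \<open>At the triggering time \<open>\<tau>\<close> times \<open>3 (M\<^sup>2 + a\<^sup>2) xi\<close> equals \<open>\<rho>\<close>. The quadratic term is thus at most
  \<open>3/4\<close> of the linear decrease \<open>\<rho> \<tau> dist_sq\<close>, and a quarter remains.\<close>

lemma lyap_decrease:
  "lyap (x - \<tau> x z *\<^sub>R gx x z) (z + \<tau> x z *\<^sub>R gz x) \<le> lyap x z - \<tau> x z * (\<rho> * dist_sq x z / 4)"
proof -
  let ?\<xi> = "xi F A \<beta>1 m M L x z" and ?c = "3 * (M\<^sup>2 + a\<^sup>2)" and ?P = "dist_sq x z"
  let ?S = "(norm (gx x z))\<^sup>2 + (norm (gz x))\<^sup>2"
  have "curvature x z * ?S \<le> (3 / 2 * ?\<xi>) * (?c * ?P)"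
    using curvature_le_xi[of x z] speed_sq_le[of x z] xi_pos[of x z]
    by (intro mult_mono) auto
  then have "\<tau> x z / 2 * (curvature x z * ?S) \<le> \<tau> x z / 2 * ((3 / 2 * ?\<xi>) * (?c * ?P))"
    using \<tau>_pos[of x z] by (intro mult_left_mono) auto
  also have "\<dots> = 3 / 4 * (\<tau> x z * (?c * ?\<xi>)) * ?P" by simp
  also have "\<tau> x z * (?c * ?\<xi>) = \<rho>"
    using gain_pos xi_pos[of x z] by (simp add: trigger_step_def)
  finally have "\<tau> x z / 2 * (curvature x z * ?S) + lyap_rate x z \<le> 3 / 4 * \<rho> * ?P + - \<rho> * ?P"
    using lyap_rate_le[of x z] by (rule add_mono)
  also have "\<dots> = - (\<rho> * ?P / 4)" by simp
  finally have "\<tau> x z / 2 * (curvature x z * ?S) + lyap_rate x z \<le> - (\<rho> * ?P / 4)" .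
  then have "\<tau> x z * (\<tau> x z / 2 * (curvature x z * ?S) + lyap_rate x z) \<le> \<tau> x z * (- (\<rho> * ?P / 4))"
    using \<tau>_pos[of x z] by (intro mult_left_mono) auto
  moreover have "lyap (x - \<tau> x z *\<^sub>R gx x z) (z + \<tau> x z *\<^sub>R gz x)
      \<le> lyap x z + \<tau> x z * (\<tau> x z / 2 * (curvature x z * ?S) + lyap_rate x z)"
  proof -
    have regroup: "v + t * (t / 2 * (k * S) + r) = v + t * r + t\<^sup>2 / 2 * k * S" for v t k S r :: real
      by (simp add: power2_eq_square algebra_simps)
    show ?thesis unfolding regroup by (rule lyap_along_step[OF less_imp_le[OF \<tau>_pos]])
  qed
  ultimately show ?thesis by simp
qed

text \<open>The waiting time obtained when \<open>|gx|\<close> is replaced by \<open>sqrt (2 v / \<beta>1)\<close>, the largest value that it can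
  have where \<open>lyap\<close> is at most \<open>v\<close>.\<close>

definition dwell :: "real \<Rightarrow> real" where
  "dwell v = \<rho> / (3 * (M\<^sup>2 + a\<^sup>2) * (sqrt 3 *
     sqrt (\<beta>1\<^sup>2 * ((M * xi2 M A + L * sqrt (2 * v / \<beta>1))\<^sup>2 + a ^ 4 + a\<^sup>2 * (xi2 M A)\<^sup>2) + \<beta>2\<^sup>2)))"

lemma dwell_pos: "0 < dwell v"
  unfolding dwell_def using xi_radicand_pos
  by (intro divide_pos_pos[OF \<rho>_pos mult_pos_pos[OF gain_pos]] mult_pos_pos) auto

lemma dwell_le_\<tau>:
  assumes v: "lyap x z \<le> v"
  shows "dwell v \<le> \<tau> x z"
proof -
  have "\<beta>1 / 2 * (norm (gx x z))\<^sup>2 \<le> v"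
  proof -
    have "0 \<le> \<beta>1 / 2 * (norm (gz x))\<^sup>2" "0 \<le> \<beta>2 / 2 * dist_sq x z"
      using \<beta>1_pos \<beta>2_pos dist_sq_nonneg[of x z] by simp_all
    then show ?thesis using v by (simp add: lyap_def distrib_left)
  qed
  then have "norm (gx x z) \<le> sqrt (2 * v / \<beta>1)"
    using \<beta>1_pos by (intro real_le_rsqrt) (simp add: field_simps)
  then have "xi1 F A M L x z \<le> M * xi2 M A + L * sqrt (2 * v / \<beta>1)"
    using L_pos by (simp add: xi1_def grad_x_F)
  moreover have "0 \<le> xi1 F A M L x z"
    using M_pos L_pos by (simp add: xi1_def xi2_def max.coboundedI1)
  ultimately have "(xi1 F A M L x z)\<^sup>2 \<le> (M * xi2 M A + L * sqrt (2 * v / \<beta>1))\<^sup>2" by (rule power_mono)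
  then have le: "xi F A \<beta>1 m M L x z \<le> sqrt 3 *
     sqrt (\<beta>1\<^sup>2 * ((M * xi2 M A + L * sqrt (2 * v / \<beta>1))\<^sup>2 + a ^ 4 + a\<^sup>2 * (xi2 M A)\<^sup>2) + \<beta>2\<^sup>2)"
    (is "_ \<le> ?R")
    unfolding xi_def by (intro mult_left_mono real_sqrt_le_mono add_right_mono) auto
  then have "0 < ?R" using xi_pos less_le_trans by blast
  with le show ?thesis
    unfolding dwell_def trigger_step_def
    by (intro divide_left_mono[OF mult_left_mono[OF le less_imp_le[OF gain_pos]] less_imp_le[OF \<rho>_pos]
          mult_pos_pos[OF mult_pos_pos[OF gain_pos] mult_pos_pos[OF gain_pos xi_pos]]])
qed

text \<open>The values of \<open>lyap\<close> decrease to a limit, so their decrements vanish; the decrements dominate a fixed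
  multiple of the squared distance because the steps are bounded below.\<close>

lemma euler_iterates_converge:
  assumes X: "\<And>k. X (Suc k) = X k - \<tau> (X k) (Z k) *\<^sub>R gx (X k) (Z k)"
    and Z: "\<And>k. Z (Suc k) = Z k + \<tau> (X k) (Z k) *\<^sub>R gz (X k)"
  shows "dwell (lyap (X 0) (Z 0)) \<le> \<tau> (X k) (Z k)"
    and "(\<lambda>k. (X k, Z k)) \<longlonglongrightarrow> (xs, zs)"
proof -
  let ?V = "\<lambda>k. lyap (X k) (Z k)" and ?P = "\<lambda>k. dist_sq (X k) (Z k)"
  let ?\<mu> = "dwell (?V 0)"
  have step: "?V (Suc k) \<le> ?V k - \<tau> (X k) (Z k) * (\<rho> * ?P k / 4)" for k
    unfolding X Z by (rule lyap_decrease)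
  have rate_nonneg: "0 \<le> \<rho> * ?P k / 4" for k using \<rho>_pos dist_sq_nonneg by simp
  have "0 \<le> \<tau> (X k) (Z k) * (\<rho> * ?P k / 4)" for k
    using \<tau>_pos rate_nonneg by (simp add: less_imp_le)
  then have "?V (Suc k) \<le> ?V k" for k using step[of k] by (smt (verit))
  then have dec: "decseq ?V" by (rule decseq_SucI)
  have \<mu>: "?\<mu> \<le> \<tau> (X k) (Z k)" for k
    by (rule dwell_le_\<tau>) (use dec in \<open>simp add: decseq_def\<close>)
  then show "?\<mu> \<le> \<tau> (X k) (Z k)" .
  define c where "c = ?\<mu> * \<rho> / 4"
  have c: "0 < c" using dwell_pos \<rho>_pos by (simp add: c_def)
  have cP: "c * ?P k \<le> ?V k - ?V (Suc k)" for k
  proof -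
    have "?\<mu> * (\<rho> * ?P k / 4) \<le> \<tau> (X k) (Z k) * (\<rho> * ?P k / 4)" by (intro mult_right_mono \<mu> rate_nonneg)
    then show ?thesis using step[of k] by (simp add: c_def)
  qed
  obtain l where l: "?V \<longlonglongrightarrow> l" using decseq_convergent[OF dec, of 0] lyap_nonneg by blast
  then have "(\<lambda>k. (?V k - ?V (Suc k)) / c) \<longlonglongrightarrow> (l - l) / c"
    using c by (intro tendsto_intros LIMSEQ_Suc) auto
  then have V0: "(\<lambda>k. (?V k - ?V (Suc k)) / c) \<longlonglongrightarrow> 0" by simp
  have "?P \<longlonglongrightarrow> 0"
  proof (rule tendsto_sandwich[OF _ _ tendsto_const V0])
    show "\<forall>\<^sub>F k in sequentially. 0 \<le> ?P k" by (simp add: dist_sq_nonneg)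
    show "\<forall>\<^sub>F k in sequentially. ?P k \<le> (?V k - ?V (Suc k)) / c"
      using cP c by (simp add: pos_le_divide_eq mult.commute)
  qed
  then have "(\<lambda>k. sqrt (?P k)) \<longlonglongrightarrow> 0" using tendsto_real_sqrt by fastforce
  moreover have "dist (X k, Z k) (xs, zs) = sqrt (?P k)" for k
    by (simp add: dist_sq_def dist_prod_def dist_norm)
  ultimately show "(\<lambda>k. (X k, Z k)) \<longlonglongrightarrow> (xs, zs)" by (subst tendsto_dist_iff) simp
qed

end


section \<open>Solutions of the sampled dynamics\<close>

locale time_grid =
  fixes T h :: "nat \<Rightarrow> real"
  assumes grid: "\<And>k. T (Suc k) = T k + h k" and h_pos: "\<And>k. 0 < h k"
begin

lemma T_mono: "j \<le> k \<Longrightarrow> T j \<le> T k"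
  by (rule lift_Suc_mono_le[of T]) (simp_all add: grid less_imp_le[OF h_pos])

lemma T_Suc_le: "T k \<le> T (Suc k)"
  by (rule T_mono) simp

text \<open>Piecewise affine interpolation: for \<open>s\<close> inside the grid, the least \<open>k\<close> with \<open>s < T (Suc k)\<close> is the index
  of the interval \<open>{T k..<T (Suc k)}\<close> that contains \<open>s\<close>.\<close>

definition interp :: "(nat \<Rightarrow> 'a::real_normed_vector) \<Rightarrow> (nat \<Rightarrow> 'a) \<Rightarrow> real \<Rightarrow> 'a" where
  "interp X v s = (let k = LEAST k. s < T (Suc k) in X k + (s - T k) *\<^sub>R v k)"

lemma index_eq:
  assumes "T k \<le> s" "s < T (Suc k)"
  shows "(LEAST j. s < T (Suc j)) = k"
proof (rule Least_equality)
  fix j assume j: "s < T (Suc j)"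
  show "k \<le> j"
  proof (rule ccontr)
    assume "\<not> k \<le> j"
    then have "T (Suc j) \<le> T k" by (intro T_mono) simp
    with assms j show False by simp
  qed
qed (rule assms)

lemma interp_eq:
  assumes X: "\<And>k. X (Suc k) = X k + h k *\<^sub>R v k" and s: "s \<in> {T k..T (Suc k)}"
  shows "interp X v s = X k + (s - T k) *\<^sub>R v k"
proof (cases "s = T (Suc k)")
  case True
  then have "(LEAST j. s < T (Suc j)) = Suc k" by (intro index_eq) (simp_all add: grid h_pos)
  then show ?thesis using True by (simp add: interp_def X grid)
next
  case False
  then have "(LEAST j. s < T (Suc j)) = k" using s by (intro index_eq) auto
  then show ?thesis by (simp add: interp_def)
qed

lemma interp_grid:
  assumes X: "\<And>k. X (Suc k) = X k + h k *\<^sub>R v k"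
  shows "interp X v (T k) = X k"
  using interp_eq[OF X, of "T k" k] T_Suc_le[of k] by simp

lemma interp_absolutely_continuous:
  assumes X: "\<And>k. X (Suc k) = X k + h k *\<^sub>R v k"
  shows "absolutely_continuous_on {T k..T (Suc k)} (interp X v)"
  by (rule affine_absolutely_continuous[OF interp_eq[OF X]])

lemma interp_has_vector_derivative:
  assumes X: "\<And>k. X (Suc k) = X k + h k *\<^sub>R v k" and s: "s \<in> {T k<..<T (Suc k)}"
  shows "(interp X v has_vector_derivative v k) (at s)"
proof (rule has_vector_derivative_transform_within_open)
  show "((\<lambda>s. X k + (s - T k) *\<^sub>R v k) has_vector_derivative v k) (at s)"
    by (auto intro!: derivative_eq_intros)
  show "X k + (r - T k) *\<^sub>R v k = interp X v r" if "r \<in> {T k<..<T (Suc k)}" for r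
    using interp_eq[OF X, of r k] that by simp
qed (use s in auto)

lemma AE_interp_has_vector_derivative:
  assumes X: "\<And>k. X (Suc k) = X k + h k *\<^sub>R v k" and Y: "\<And>k. Y (Suc k) = Y k + h k *\<^sub>R w k"
  shows "AE s in lebesgue. s \<in> {T k..<T (Suc k)} \<longrightarrow>
    (interp X v has_vector_derivative v k) (at s) \<and> (interp Y w has_vector_derivative w k) (at s)"
proof -
  have "{T k} \<in> null_sets lebesgue" by (metis negligible_iff_null_sets negligible_sing)
  then have "AE s in lebesgue. s \<notin> {T k}" by (rule AE_not_in)
  then show ?thesis
  proof eventually_elim
    case (elim s)
    show ?case
    proof
      assume "s \<in> {T k..<T (Suc k)}"
      with elim have "s \<in> {T k<..<T (Suc k)}" by auto
      then show "(interp X v has_vector_derivative v k) (at s) \<and> (interp Y w has_vector_derivative w k) (at s)"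
        using interp_has_vector_derivative[OF X] interp_has_vector_derivative[OF Y] by blast
    qed
  qed
qed

end

context self_triggered_flow
begin

text \<open>Linear interpolation of the Euler iterates, each step being the waiting time of the current iterate.\<close>

lemma solution_exists:
  "\<exists>t x z. self_triggered_solution F \<tau> t x z \<and> x 0 = x0 \<and> z 0 = z0"
proof -
  define P where "P = rec_nat (x0, z0)
    (\<lambda>_ (x, z). (x + \<tau> x z *\<^sub>R - gx x z, z + \<tau> x z *\<^sub>R gz x))"
  define X Z where "X k = fst (P k)" and "Z k = snd (P k)" for k
  define h where "h k = \<tau> (X k) (Z k)" for k
  define T where "T k = sum h {..<k}" for k
  let ?v = "\<lambda>k. - gx (X k) (Z k)" and ?w = "\<lambda>k. gz (X k)"
  have X: "X (Suc k) = X k + h k *\<^sub>R ?v k" and Z: "Z (Suc k) = Z k + h k *\<^sub>R ?w k" for k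
    by (simp_all add: X_def Z_def h_def P_def split_beta)
  interpret time_grid T h
    by unfold_locales (simp_all add: T_def h_def \<tau>_pos)
  let ?x = "interp X ?v" and ?z = "interp Z ?w"
  have x: "?x (T k) = X k" and z: "?z (T k) = Z k" for k
    by (rule interp_grid[OF X], rule interp_grid[OF Z])
  have T0: "T 0 = 0" by (simp add: T_def)
  have "self_triggered_solution F \<tau> T ?x ?z"
    unfolding self_triggered_solution_def x z grad_x_F grad_z_F
  proof (intro conjI allI)
    show "T (Suc k) = T k + \<tau> (X k) (Z k)" for k by (simp add: grid h_def)
    show "absolutely_continuous_on {T k..T (Suc k)} ?x" for k by (rule interp_absolutely_continuous[OF X])
    show "absolutely_continuous_on {T k..T (Suc k)} ?z" for k by (rule interp_absolutely_continuous[OF Z])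
    show "AE s in lebesgue. s \<in> {T k..<T (Suc k)} \<longrightarrow>
      (?x has_vector_derivative - gx (X k) (Z k)) (at s) \<and> (?z has_vector_derivative gz (X k)) (at s)" for k
      by (rule AE_interp_has_vector_derivative[OF X Z])
  qed (rule T0)
  moreover have "?x 0 = x0" "?z 0 = z0"
    using x[of 0] z[of 0] by (simp_all add: T0 X_def Z_def P_def)
  ultimately show ?thesis by blast
qed

text \<open>On each sampling interval the prescribed derivative is constant, so the increments of the solution are those
  of the Euler scheme.\<close>

lemma solution_converges:
  assumes sol: "self_triggered_solution F \<tau> t x z"
  shows "(\<lambda>k. (x (t k), z (t k))) \<longlonglongrightarrow> (xs, zs)"
    and "dwell (lyap (x 0) (z 0)) \<le> t (Suc k) - t k"
proof -
  let ?X = "\<lambda>k. x (t k)" and ?Z = "\<lambda>k. z (t k)"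
  have t0: "t 0 = 0" and tS: "t (Suc k) = t k + \<tau> (?X k) (?Z k)"
    and acx: "absolutely_continuous_on {t k..t (Suc k)} x"
    and acz: "absolutely_continuous_on {t k..t (Suc k)} z"
    and ae: "AE s in lebesgue. s \<in> {t k..<t (Suc k)} \<longrightarrow>
      (x has_vector_derivative - gx (?X k) (?Z k)) (at s) \<and> (z has_vector_derivative gz (?X k)) (at s)" for k
    using sol unfolding self_triggered_solution_def grad_x_F grad_z_F by blast+
  have le: "t k \<le> t (Suc k)" for k using \<tau>_pos[of "?X k" "?Z k"] by (simp add: tS)
  have X: "?X (Suc k) = ?X k - \<tau> (?X k) (?Z k) *\<^sub>R gx (?X k) (?Z k)" for k
  proof -
    have "AE s in lebesgue. s \<in> {t k..<t (Suc k)} \<longrightarrow> (x has_vector_derivative - gx (?X k) (?Z k)) (at s)"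
      using ae[of k] by eventually_elim blast
    from absolutely_continuous_affine_increment[OF le acx this]
    have "?X (Suc k) = ?X k + (t (Suc k) - t k) *\<^sub>R - gx (?X k) (?Z k)" by (metis add.commute diff_add_cancel)
    then show ?thesis by (simp only: tS scaleR_minus_right add_diff_cancel_left' add_uminus_conv_diff)
  qed
  have Z: "?Z (Suc k) = ?Z k + \<tau> (?X k) (?Z k) *\<^sub>R gz (?X k)" for k
  proof -
    have "AE s in lebesgue. s \<in> {t k..<t (Suc k)} \<longrightarrow> (z has_vector_derivative gz (?X k)) (at s)"
      using ae[of k] by eventually_elim blast
    from absolutely_continuous_affine_increment[OF le acz this]
    have "?Z (Suc k) = ?Z k + (t (Suc k) - t k) *\<^sub>R gz (?X k)" by (metis add.commute diff_add_cancel)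
    then show ?thesis by (simp only: tS add_diff_cancel_left')
  qed
  show "(\<lambda>k. (?X k, ?Z k)) \<longlonglongrightarrow> (xs, zs)"
    by (rule euler_iterates_converge(2)[of ?X ?Z, OF X Z])
  show "dwell (lyap (x 0) (z 0)) \<le> t (Suc k) - t k"
    using euler_iterates_converge(1)[of ?X ?Z, OF X Z, of k] by (simp add: tS t0)
qed

end

theorem theorem6p8:
  fixes f :: "real^'n \<Rightarrow> real" and A :: "real^'n^'q" and b :: "real^'q"
    and F :: "real^'n \<Rightarrow> real^'q \<Rightarrow> real"
    and m M L \<beta>1 :: real
  assumes F_eq: "\<And>x z. F x z = f x + z \<bullet> (A *v x - b)"
    and full_row_rank: "rank A = CARD('q)"
    and "strongly_convex f"
    and "twice_differentiable f"
    and "0 < m" and "m \<le> M"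
    and hessian_bounds: "\<And>x. m *\<^sub>R mat 1 \<preceq> hessian f x \<and> hessian f x \<preceq> M *\<^sub>R mat 1"
    and "0 < L"
    and hessian_lipschitz: "\<And>x y. matrix_norm (hessian f x - hessian f y) \<le> L * norm (x - y)"
    and "0 < \<beta>1"
  shows "\<exists>xs zs. Saddle F = {(xs, zs)} \<and>
    (\<forall>x0 z0.
       (\<exists>t x z. self_triggered_solution F (trigger_step F A \<beta>1 m M L) t x z \<and> x 0 = x0 \<and> z 0 = z0) \<and>
       (\<exists>\<mu>>0. \<forall>t x z.
          self_triggered_solution F (trigger_step F A \<beta>1 m M L) t x z \<and> x 0 = x0 \<and> z 0 = z0 \<longrightarrow>
          (\<lambda>k. (x (t k), z (t k))) \<longlonglongrightarrow> (xs, zs) \<and>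
          (\<forall>k. t (Suc k) - t k \<ge> \<mu>)))"
proof -
  interpret strongly_convex_lagrangian f A b m M L
    using assms by unfold_locales auto
  obtain xs zs where crit: "critical xs zs" by (rule critical_exists)
  interpret self_triggered_flow f A b m M L \<beta>1 xs zs
    using \<open>0 < \<beta>1\<close> crit by unfold_locales
  have F: "F = (\<lambda>x z. f x + z \<bullet> (A *v x - b))" using F_eq by (intro ext)
  have "Saddle F = {(xs, zs)}"
    unfolding F Saddle_eq_critical using crit critical_unique by auto
  moreover have "\<exists>t x z. self_triggered_solution F (trigger_step F A \<beta>1 m M L) t x z \<and> x 0 = x0 \<and> z 0 = z0" for x0 z0
    unfolding F by (rule solution_exists)
  moreover have "\<exists>\<mu>>0. \<forall>t x z.
          self_triggered_solution F (trigger_step F A \<beta>1 m M L) t x z \<and> x 0 = x0 \<and> z 0 = z0 \<longrightarrow>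
          (\<lambda>k. (x (t k), z (t k))) \<longlonglongrightarrow> (xs, zs) \<and> (\<forall>k. t (Suc k) - t k \<ge> \<mu>)" for x0 z0
  proof (intro exI[of _ "dwell (lyap x0 z0)"] conjI allI impI dwell_pos; elim conjE)
    fix t x z
    assume sol: "self_triggered_solution F (trigger_step F A \<beta>1 m M L) t x z" and init: "x 0 = x0" "z 0 = z0"
    show "(\<lambda>k. (x (t k), z (t k))) \<longlonglongrightarrow> (xs, zs)"
      by (rule solution_converges(1)[OF sol[unfolded F]])
    show "dwell (lyap x0 z0) \<le> t (Suc k) - t k" for k
      using solution_converges(2)[OF sol[unfolded F], of k] unfolding init .
  qed
  ultimately show ?thesis by blast
qed


end
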